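(* There exists a positive constant $l$ such that for every real $X\ge2$, $$l\,\frac{X}{\log X}\le \#\{n\le X : n \text{ is squarefree and } \varphi^*\text{-practical}\}\le F_{\varphi^*}(X),$$ where $F_{\varphi^*}(X)$ is the number of $\varphi^*$-practical positive integers $n\le X$.
   Context: $\varphi^*$ is the multiplicative function with $\varphi^*(p^k)=p^k-1$ for primes $p$ and $k\ge1$. $S_{\varphi^*}(n)=\sum_{d\mid n}\varphi^*(d)$. A positive integer $n$ is $\varphi^*$-practical if every positive integer $m\le S_{\varphi^*}(n)$ equals $\sum_{d\in\mathcal{D}}\varphi^*(d)$ for some set $\mathcal{D}$ of distinct divisors of $n$. *)

theory Defs
  imports "HOL-Computational_Algebra.Computational_Algebra" Complex_Main
begin

definition phi_star :: "nat \<Rightarrow> nat" where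
  "phi_star n = (\<Prod>p\<in>prime_factors n. p ^ multiplicity p n - 1)"

definition S_phi_star :: "nat \<Rightarrow> nat" where
  "S_phi_star n = (\<Sum>d | d dvd n. phi_star d)"

definition phi_star_practical :: "nat \<Rightarrow> bool" where
  "phi_star_practical n \<longleftrightarrow> n > 0 \<and>
     (\<forall>m. 0 < m \<and> m \<le> S_phi_star n \<longrightarrow>
        (\<exists>D. D \<subseteq> {d. d dvd n} \<and> m = (\<Sum>d\<in>D. phi_star d)))"

definition F_phi_star :: "real \<Rightarrow> nat" where
  "F_phi_star X = card {n::nat. 0 < n \<and> real n \<le> X \<and> phi_star_practical n}"

end

theory Submission
  imports Defs "HOL-Analysis.Analysis" "HOL-Real_Asymp.Real_Asymp"
begin

text \<open>
  If \<open>n\<close> is squarefree and practical and \<open>p \<le> n + 2\<close> is a prime not dividing \<open>n\<close>, then \<open>p * n\<close> is again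
  squarefree and practical. Starting from a fixed primorial \<open>m0\<close>, run through the primes in increasing
  order, let a random squarefree number \<open>n\<close> acquire the prime \<open>p\<close> with probability \<open>1 / (p + 1)\<close>, and stop it as
  soon as the current prime exceeds it. Then \<open>ln n\<close> minus the sum of \<open>ln p / (p + 1)\<close> over the primes
  passed is a martingale, and by Mertens' first theorem it is bounded at the stopping time. Since
  \<open>ln m0\<close> exceeds this bound for a large primorial, the expectation of \<open>ln n\<close> over the numbers that survive
  up to \<open>N\<close> is bounded below by a positive constant. A second moment bound shows that survivors of size at most
  \<open>N ^ J\<close> account for half of it, and therefore the reciprocals of the practical numbers in
  \<open>{N..N ^ J}\<close> have a sum bounded below. Multiplying these numbers by boundedly many primes of controlled size, the
  last one of size about \<open>X / n\<close>, yields the order \<open>X / ln X\<close>.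
\<close>

subsection \<open>Chebyshev and Mertens estimates\<close>

text \<open>Acquiring \<open>p\<close> with probability \<open>1 / (p + 1)\<close> gives
  \<open>n\<close> a weight proportional to \<open>1 / n\<close>, so expectations are reciprocal
  sums divided by an Euler product that is at least a constant times \<open>ln N\<close>. A
  reciprocal sum bounded below thus asks for a survival probability of order
  \<open>1 / ln N\<close>. Two obstacles shape the rest. The lower bound for the mean of
  \<open>ln n\<close> could come from a few huge \<open>n\<close>. Excluding this by a second moment
  needs an upper bound of order \<open>1 / ln N\<close> for the survival probability, and the mean
  of \<open>ln n - ln N\<close> says little about \<open>n\<close> close to \<open>N\<close>;
  multiplication by a prime between \<open>N^(3/4)\<close> and \<open>N\<close> moves such
  \<open>n\<close> away from \<open>N\<close>. Moreover, a last prime near \<open>X / n\<close> is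
  admissible only up to \<open>n + 2\<close>, so \<open>n\<close> must reach about the square root
  of \<open>X\<close>, whereas \<open>n\<close> is only known to lie between \<open>N\<close> and
  \<open>N^J\<close>. Multiplying by \<open>2J\<close> primes between \<open>N^(3/4)\<close> and
  \<open>N\<close> turns the exponents \<open>1\<close> and \<open>J\<close> into
  \<open>1 + 3J/2\<close> and \<open>3J\<close>. Since \<open>2 (1 + 3J/2) > 3J + 1\<close>, an
  \<open>X\<close> of size about \<open>N^(3J+1)\<close> is then reached from every such
  \<open>n\<close>.\<close>

definition primes_upto :: "nat \<Rightarrow> nat set" where
  "primes_upto N = {p. prime p \<and> p \<le> N}"

lemma finite_primes_upto [simp, intro]: "finite (primes_upto N)"
  by (rule finite_subset[of _ "{..N}"]) (auto simp: primes_upto_def)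

lemma primes_upto_Suc:
  "primes_upto (Suc N) = (if prime (Suc N) then insert (Suc N) (primes_upto N) else primes_upto N)"
  by (auto simp: primes_upto_def le_Suc_eq)

lemma prod_primes_dvd:
  fixes m :: nat
  assumes "finite A" "\<And>p. p \<in> A \<Longrightarrow> prime p \<and> p dvd m"
  shows "\<Prod>A dvd m"
  using assms
proof (induction A rule: finite_induct)
  case (insert x A)
  have "coprime x (\<Prod>p\<in>A. p)"
    using insert by (intro prod_coprime_right) (metis insert_iff primes_coprime)
  hence "x * \<Prod>A dvd m" using insert by (intro divides_mult) auto
  thus ?case using insert by simp
qed simp

lemma sum_ln_primes_le:
  fixes m :: nat
  assumes "finite A" "\<And>p. p \<in> A \<Longrightarrow> prime p \<and> p dvd m" "m > 0"
  shows "(\<Sum>p\<in>A. ln (real p)) \<le> ln (real m)"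
proof -
  have pos: "\<And>p. p \<in> A \<Longrightarrow> p > 0" using assms prime_gt_0_nat by auto
  have "(\<Sum>p\<in>A. ln (real p)) = ln (\<Prod>p\<in>A. real p)"
    using assms(1) pos by (subst ln_prod) auto
  also have "(\<Prod>p\<in>A. real p) = real (\<Prod>A)" by simp
  also have "ln \<dots> \<le> ln (real m)"
  proof -
    have "\<Prod>A \<le> m" using prod_primes_dvd[of A m] assms dvd_imp_le by blast
    moreover have "\<Prod>A > 0" using pos by (intro prod_pos) auto
    ultimately show ?thesis by (simp del: of_nat_prod)
  qed
  finally show ?thesis .
qed

text \<open>Caps the number of ways to write \<open>k\<close> as \<open>p * n\<close> with
  \<open>p\<close> from a set of large primes; the multiplicity bounds below all come from
  here.\<close>

lemma card_primes_dvd_le: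
  fixes k :: nat and y :: real
  assumes "finite A" "\<And>p. p \<in> A \<Longrightarrow> prime p \<and> p dvd k" "k > 0"
    and "\<And>p. p \<in> A \<Longrightarrow> y \<le> ln (real p)"
  shows "real (card A) * y \<le> ln (real k)"
proof -
  have "real (card A) * y = (\<Sum>p\<in>A. y)" by simp
  also have "\<dots> \<le> (\<Sum>p\<in>A. ln (real p))" using assms by (intro sum_mono) auto
  also have "\<dots> \<le> ln (real k)" using assms by (intro sum_ln_primes_le) auto
  finally show ?thesis .
qed

definition chebyshev_theta :: "nat \<Rightarrow> real" where
  "chebyshev_theta n = (\<Sum>p\<in>primes_upto n. ln (real p))"

lemma chebyshev_theta_mono: "m \<le> n \<Longrightarrow> chebyshev_theta m \<le> chebyshev_theta n"
  unfolding chebyshev_theta_def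
  by (intro sum_mono2) (auto simp: primes_upto_def dest: prime_gt_0_nat)

text \<open>The primes in \<open>(n, 2n]\<close> divide the central binomial coefficient, because
  they divide \<open>(2n)!\<close> but not \<open>n!\<close>.\<close>

lemma chebyshev_theta_double:
  assumes "n > 0"
  shows "chebyshev_theta (2 * n) \<le> chebyshev_theta n + 2 * real n * ln 2"
proof -
  let ?A = "primes_upto (2 * n) - primes_upto n"
  have sub: "primes_upto n \<subseteq> primes_upto (2 * n)" by (auto simp: primes_upto_def)
  have "chebyshev_theta (2 * n) - chebyshev_theta n = (\<Sum>p\<in>?A. ln (real p))"
    unfolding chebyshev_theta_def using sub by (subst sum_diff) auto
  also have "\<dots> \<le> ln (real ((2 * n) choose n))"
  proof (rule sum_ln_primes_le)
    fix p assume p: "p \<in> ?A"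
    hence pr: "prime p" and le: "p \<le> 2 * n" and gt: "p > n" by (auto simp: primes_upto_def)
    have "p dvd fact (2 * n)" using pr le by (simp add: prime_dvd_fact_iff)
    moreover have "fact (2 * n) = fact n * fact n * ((2 * n) choose n)"
      using binomial_fact_lemma[of n "2 * n"] by (simp add: mult_2)
    ultimately have "p dvd fact n * fact n * ((2 * n) choose n)" by metis
    moreover have "\<not> p dvd fact n" using pr gt by (simp add: prime_dvd_fact_iff)
    ultimately have "p dvd ((2 * n) choose n)" using pr by (simp add: prime_dvd_mult_iff)
    thus "prime p \<and> p dvd ((2 * n) choose n)" using pr by simp
  qed auto
  also have "\<dots> \<le> ln (2 ^ (2 * n))"
  proof -
    have "((2 * n) choose n) \<le> 2 ^ (2 * n)" by (rule binomial_le_pow2)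
    hence "real ((2 * n) choose n) \<le> 2 ^ (2 * n)" using of_nat_mono by fastforce
    thus ?thesis by (subst ln_le_cancel_iff) (auto simp: zero_less_binomial)
  qed
  also have "\<dots> = 2 * real n * ln 2" by (simp add: ln_realpow)
  finally show ?thesis by simp
qed

text \<open>The constant \<open>2 * ln 2\<close> would carry the induction through even arguments;
  \<open>4 * ln 2\<close> leaves room that, for \<open>k > 0\<close>, pays for rounding
  \<open>2k + 1\<close> up to \<open>2k + 2\<close>.\<close>

lemma chebyshev_theta_le: "chebyshev_theta n \<le> 4 * ln 2 * real n"
proof (induction n rule: less_induct)
  case (less n)
  consider "n = 0" | "n = 1" | k where "n = 2 * k" "k > 0" | k where "n = 2 * k + 1" "k > 0"
  proof -
    have "n = 2 * (n div 2) \<or> n = 2 * (n div 2) + 1" by arith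
    thus ?thesis using that by (metis add_0 mult_0_right neq0_conv)
  qed
  thus ?case
  proof cases
    case 1
    thus ?thesis by (simp add: chebyshev_theta_def primes_upto_def)
  next
    case 2
    hence "primes_upto n = {}" by (auto simp: primes_upto_def dest: prime_gt_1_nat)
    thus ?thesis by (simp add: chebyshev_theta_def)
  next
    case (3 k)
    have "chebyshev_theta n \<le> chebyshev_theta k + 2 * real k * ln 2"
      using chebyshev_theta_double[of k] 3 by simp
    also have "\<dots> \<le> 4 * ln 2 * real k + 2 * real k * ln 2" using less.IH[of k] 3 by (simp add: mult_ac)
    also have "\<dots> \<le> 4 * ln 2 * real n" using 3 by (simp add: algebra_simps)
    finally show ?thesis .
  next
    case (4 k)
    have "chebyshev_theta n \<le> chebyshev_theta (2 * (k + 1))"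
      using 4 by (intro chebyshev_theta_mono) auto
    also have "\<dots> \<le> chebyshev_theta (k + 1) + 2 * real (k + 1) * ln 2"
      by (rule chebyshev_theta_double) simp
    also have "\<dots> \<le> 4 * ln 2 * real (k + 1) + 2 * real (k + 1) * ln 2"
      using less.IH[of "k + 1"] 4 by (simp del: of_nat_add)
    also have "\<dots> = (6 * real k + 6) * ln 2" by (simp add: algebra_simps)
    also have "\<dots> \<le> (8 * real k + 4) * ln 2" using 4 by (intro mult_right_mono) auto
    also have "\<dots> = 4 * ln 2 * real n" using 4 by (simp add: algebra_simps)
    finally show ?thesis .
  qed
qed

section \<open>Mertens' first theorem from the size of \<open>ln (n!)\<close>\<close>

lemma ln_fact_eq_sum: "ln (fact n :: real) = (\<Sum>m\<in>{1..n}. ln (real m))"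
  unfolding fact_prod by (subst of_nat_prod, subst ln_prod) auto

lemma ln_fact_le: "ln (fact n :: real) \<le> real n * ln (real n)"
proof -
  have "(\<Sum>m\<in>{1..n}. ln (real m)) \<le> (\<Sum>m\<in>{1..n}. ln (real n))" by (intro sum_mono) auto
  thus ?thesis by (simp add: ln_fact_eq_sum)
qed

text \<open>\<open>n^n / n!\<close> is a single term of the exponential series at \<open>n\<close>,
  hence at most \<open>exp n\<close>.\<close>

lemma ln_fact_ge:
  assumes "n > 0"
  shows "real n * ln (real n) - real n \<le> ln (fact n :: real)"
proof -
  have s: "summable (\<lambda>k. real n ^ k /\<^sub>R fact k)"
    using exp_converges[of "real n"] by (rule sums_summable)
  have "(\<Sum>k\<in>{n}. real n ^ k /\<^sub>R fact k) \<le> exp (real n)"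
    unfolding exp_def by (intro sum_le_suminf s) auto
  hence "real n ^ n \<le> exp (real n) * fact n" by (simp add: field_simps)
  hence "ln (real n ^ n) \<le> ln (exp (real n) * fact n)" using assms by (subst ln_le_cancel_iff) auto
  thus ?thesis using assms by (simp add: ln_realpow ln_mult)
qed

lemma card_multiples_upto: "d > 0 \<Longrightarrow> card {m\<in>{1..n}. d dvd m} = n div d"
proof -
  assume d: "d > 0"
  have "{m\<in>{1..n}. d dvd m} = (\<lambda>k. d * k) ` {1..n div d}"
  proof (intro set_eqI iffI)
    fix m assume "m \<in> {m\<in>{1..n}. d dvd m}"
    then obtain k where k: "m = d * k" "1 \<le> m" "m \<le> n" by auto
    hence "k \<le> n div d" using d by (metis div_le_mono nonzero_mult_div_cancel_left not_gr_zero)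
    moreover have "k \<ge> 1" using k by (cases k) auto
    ultimately show "m \<in> (\<lambda>k. d * k) ` {1..n div d}" using k by auto
  next
    fix m assume "m \<in> (\<lambda>k. d * k) ` {1..n div d}"
    then obtain k where k: "m = d * k" "1 \<le> k" "k \<le> n div d" by (metis atLeastAtMost_iff imageE)
    have "d * (n div d) \<le> n" by simp
    hence "d * k \<le> n" using mult_le_mono2[OF k(3), of d] by linarith
    thus "m \<in> {m\<in>{1..n}. d dvd m}" using d k(1,2) by simp
  qed
  moreover have "inj_on (\<lambda>k. d * k) {1..n div d}" using d by (auto simp: inj_on_def)
  ultimately show ?thesis by (simp add: card_image)
qed

text \<open>Distinct primes dividing \<open>m\<close> multiply to at most \<open>m\<close>; summing
  over \<open>m\<close> bounds the sum of \<open>ln p * (n div p)\<close> by \<open>n ln n\<close>.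
  Passing from \<open>n div p\<close> to \<open>n / p\<close> costs at most \<open>ln p\<close> per
  prime, in total \<open>chebyshev_theta n\<close>, which is linear in \<open>n\<close>.\<close>

lemma sum_ln_prime_over_prime_le:
  assumes "n > 0"
  shows "(\<Sum>p\<in>primes_upto n. ln (real p) / real p) \<le> ln (real n) + 4 * ln 2"
proof -
  have "(\<Sum>p\<in>primes_upto n. ln (real p) * real (n div p))
      = (\<Sum>p\<in>primes_upto n. \<Sum>m\<in>{m\<in>{1..n}. p dvd m}. ln (real p))"
  proof (intro sum.cong refl)
    fix p assume "p \<in> primes_upto n"
    hence "p > 0" by (auto simp: primes_upto_def prime_gt_0_nat)
    thus "ln (real p) * real (n div p) = (\<Sum>m\<in>{m\<in>{1..n}. p dvd m}. ln (real p))"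
      using card_multiples_upto[of p n] by simp
  qed
  also have "\<dots> = (\<Sum>m\<in>{1..n}. \<Sum>p\<in>{p\<in>primes_upto n. p dvd m}. ln (real p))"
    by (rule sum.swap_restrict) auto
  also have "\<dots> \<le> (\<Sum>m\<in>{1..n}. ln (real m))"
    by (intro sum_mono sum_ln_primes_le) (auto simp: primes_upto_def)
  also have "\<dots> \<le> real n * ln (real n)" using ln_fact_le ln_fact_eq_sum by metis
  finally have up: "(\<Sum>p\<in>primes_upto n. ln (real p) * real (n div p)) \<le> real n * ln (real n)" .
  have "real n * (\<Sum>p\<in>primes_upto n. ln (real p) / real p) - chebyshev_theta n
      = (\<Sum>p\<in>primes_upto n. ln (real p) * (real n / real p - 1))"
    by (simp add: chebyshev_theta_def sum_distrib_left sum_subtractf algebra_simps)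
  also have "\<dots> \<le> (\<Sum>p\<in>primes_upto n. ln (real p) * real (n div p))"
  proof (intro sum_mono mult_left_mono)
    fix p assume "p \<in> primes_upto n"
    hence p: "p > 0" by (auto simp: primes_upto_def prime_gt_0_nat)
    show "real n / real p - 1 \<le> real (n div p)"
      using floor_divide_of_nat_eq[of n p, where ?'a = real] by linarith
    show "0 \<le> ln (real p)" using p by simp
  qed
  finally have "real n * (\<Sum>p\<in>primes_upto n. ln (real p) / real p) \<le> real n * ln (real n) + 4 * ln 2 * real n"
    using up chebyshev_theta_le[of n] by linarith
  hence "real n * (\<Sum>p\<in>primes_upto n. ln (real p) / real p) \<le> real n * (ln (real n) + 4 * ln 2)"
    by (simp add: algebra_simps)
  thus ?thesis using assms by simp
qed

lemma sum_inverse_powers_le: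
  fixes x :: real
  assumes "x > 1"
  shows "(\<Sum>k\<in>{1..n}. 1 / x ^ k) \<le> 1 / (x - 1)"
proof -
  have "(\<Sum>k\<in>{1..n}. 1 / x ^ k) = (1 - 1 / x ^ n) / (x - 1)"
  proof (induction n)
    case (Suc n)
    have "(\<Sum>k\<in>{1..Suc n}. 1 / x ^ k) = (1 - 1 / x ^ n) / (x - 1) + 1 / x ^ Suc n"
      using Suc by simp
    also have "\<dots> = (1 - 1 / x ^ Suc n) / (x - 1)" using assms by (simp add: field_simps)
    finally show ?case .
  qed simp
  also have "\<dots> \<le> 1 / (x - 1)" using assms by (intro divide_right_mono) auto
  finally show ?thesis .
qed

text \<open>The range \<open>{1..n}\<close> of exponents is the same for all \<open>p\<close> and
  \<open>m\<close>, so that the sums over \<open>m\<close> and \<open>k\<close> can be interchanged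
  in Legendre's formula.\<close>

lemma multiplicity_eq_card:
  assumes "prime p" "m \<in> {1..n}"
  shows "multiplicity p m = card {k\<in>{1..n}. p ^ k dvd m}"
proof -
  have p: "p > 1" using assms prime_gt_1_nat by auto
  have dvd: "p ^ k dvd m \<longleftrightarrow> k \<le> multiplicity p m" for k
    using assms p by (intro power_dvd_iff_le_multiplicity) auto
  have "multiplicity p m \<le> n"
  proof -
    have "p ^ multiplicity p m dvd m" by (rule multiplicity_dvd)
    hence "p ^ multiplicity p m \<le> m" using assms by (intro dvd_imp_le) auto
    moreover have "multiplicity p m < p ^ multiplicity p m" using p by (intro power_gt_expt) simp
    ultimately show ?thesis using assms by simp
  qed
  hence "{k\<in>{1..n}. p ^ k dvd m} = {1..multiplicity p m}" by (auto simp: dvd)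
  thus ?thesis by simp
qed

text \<open>The exponent of \<open>p\<close> in \<open>n!\<close> is the sum of
  \<open>n div p^k\<close>, at most \<open>n / (p - 1)\<close> by the geometric series; this is
  compared with \<open>ln (n!) \<ge> n ln n - n\<close>.\<close>

lemma sum_ln_prime_over_pred_ge:
  assumes "n > 0"
  shows "ln (real n) - 1 \<le> (\<Sum>p\<in>primes_upto n. ln (real p) / (real p - 1))"
proof -
  have "real n * ln (real n) - real n \<le> (\<Sum>m\<in>{1..n}. ln (real m))"
    using ln_fact_ge[OF assms] ln_fact_eq_sum[of n] by simp
  also have "\<dots> = (\<Sum>m\<in>{1..n}. \<Sum>p\<in>primes_upto n. ln (real p) * real (multiplicity p m))"
  proof (intro sum.cong refl)
    fix m assume m: "m \<in> {1..n}"
    have "ln (real m) = ln (real (\<Prod>p\<in>prime_factors m. p ^ multiplicity p m))"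
      using m prime_factorization_nat[of m] by simp
    also have "\<dots> = ln (\<Prod>p\<in>prime_factors m. real p ^ multiplicity p m)" by simp
    also have "\<dots> = (\<Sum>p\<in>prime_factors m. ln (real p ^ multiplicity p m))"
      by (subst ln_prod) (auto intro!: zero_less_power simp: prime_factors_gt_0_nat)
    also have "\<dots> = (\<Sum>p\<in>prime_factors m. ln (real p) * real (multiplicity p m))"
      by (intro sum.cong refl, subst ln_realpow) (auto simp: prime_factors_gt_0_nat)
    also have "\<dots> = (\<Sum>p\<in>primes_upto n. ln (real p) * real (multiplicity p m))"
    proof (rule sum.mono_neutral_left)
      show "prime_factors m \<subseteq> primes_upto n"
      proof
        fix p assume p: "p \<in> prime_factors m"
        hence "p dvd m" "prime p" by auto
        thus "p \<in> primes_upto n" using m dvd_imp_le[of p m] by (auto simp: primes_upto_def)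
      qed
      show "\<forall>p\<in>primes_upto n - prime_factors m. ln (real p) * real (multiplicity p m) = 0"
        using m by (auto simp: primes_upto_def prime_factors_multiplicity)
    qed auto
    finally show "ln (real m) = (\<Sum>p\<in>primes_upto n. ln (real p) * real (multiplicity p m))" .
  qed
  also have "\<dots> = (\<Sum>p\<in>primes_upto n. ln (real p) * (\<Sum>m\<in>{1..n}. real (multiplicity p m)))"
    by (subst sum.swap) (simp add: sum_distrib_left)
  also have "\<dots> \<le> (\<Sum>p\<in>primes_upto n. ln (real p) * (real n / (real p - 1)))"
  proof (intro sum_mono mult_left_mono)
    fix p assume "p \<in> primes_upto n"
    hence p: "prime p" "p > 1" by (auto simp: primes_upto_def dest: prime_gt_1_nat)
    show "0 \<le> ln (real p)" using p by simp
    have "(\<Sum>m\<in>{1..n}. real (multiplicity p m)) = (\<Sum>m\<in>{1..n}. \<Sum>k\<in>{k\<in>{1..n}. p ^ k dvd m}. 1)"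
      using multiplicity_eq_card[OF p(1), of _ n] by (intro sum.cong) auto
    also have "\<dots> = (\<Sum>k\<in>{1..n}. \<Sum>m\<in>{m\<in>{1..n}. p ^ k dvd m}. 1)"
      by (rule sum.swap_restrict) auto
    also have "\<dots> = (\<Sum>k\<in>{1..n}. real (n div p ^ k))"
      using card_multiples_upto[of "p ^ _" n] p by (intro sum.cong) auto
    also have "\<dots> \<le> (\<Sum>k\<in>{1..n}. real n * (1 / real p ^ k))"
      using of_nat_div_le_of_nat[of n "p ^ _", where ?'a = real] by (intro sum_mono) simp
    also have "\<dots> = real n * (\<Sum>k\<in>{1..n}. 1 / real p ^ k)" by (simp add: sum_distrib_left)
    also have "\<dots> \<le> real n * (1 / (real p - 1))"
      using p by (intro mult_left_mono sum_inverse_powers_le) auto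
    finally show "(\<Sum>m\<in>{1..n}. real (multiplicity p m)) \<le> real n / (real p - 1)" by simp
  qed
  also have "\<dots> = real n * (\<Sum>p\<in>primes_upto n. ln (real p) / (real p - 1))"
    by (simp add: sum_distrib_left mult_ac)
  finally have "real n * (ln (real n) - 1) \<le> real n * (\<Sum>p\<in>primes_upto n. ln (real p) / (real p - 1))"
    by (simp add: algebra_simps)
  thus ?thesis using assms by simp
qed

definition mertens_sum :: "nat \<Rightarrow> real" where
  "mertens_sum N = (\<Sum>p\<in>primes_upto N. ln (real p) / (real p + 1))"

text \<open>Changing the denominator \<open>p\<close> to \<open>p + 1\<close> only helps the upper
  bound. For the lower bound, \<open>f\<close> is the exact difference between the terms with
  \<open>p - 1\<close> and \<open>p + 1\<close>, and its sum over all integers converges.\<close>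

lemma mertens_sum_bound:
  obtains K where "K \<ge> 0" "\<And>N. N \<ge> 1 \<Longrightarrow> \<bar>mertens_sum N - ln (real N)\<bar> \<le> K"
proof -
  define f where "f = (\<lambda>k::nat. 2 * ln (real k) / ((real k - 1) * (real k + 1)))"
  have "summable (\<lambda>k. real k powr (-3/2))" by (simp add: summable_real_powr_iff)
  moreover have "f \<in> O(\<lambda>k. real k powr (-3/2))" unfolding f_def by real_asymp
  ultimately have sf: "summable f"
    by (intro summable_comparison_test_bigo[of "\<lambda>k. real k powr (-3/2)" f]) auto
  have nn: "f k \<ge> 0" for k
    by (cases "k = 0") (simp_all add: f_def)
  define K where "K = suminf f + 4"
  have K4: "suminf f \<ge> 0" using nn by (intro suminf_nonneg sf) auto
  have "\<bar>mertens_sum N - ln (real N)\<bar> \<le> K" if N: "N \<ge> 1" for N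
  proof -
    have "mertens_sum N \<le> (\<Sum>p\<in>primes_upto N. ln (real p) / real p)"
      unfolding mertens_sum_def
      by (intro sum_mono divide_left_mono) (auto simp: primes_upto_def prime_gt_0_nat dest: prime_gt_0_nat)
    also have "\<dots> \<le> ln (real N) + 4 * ln 2" using N by (intro sum_ln_prime_over_prime_le) auto
    also have "4 * ln 2 \<le> (4::real)" using ln_2_less_1 by simp
    finally have up: "mertens_sum N \<le> ln (real N) + 4" by simp
    have "(\<Sum>p\<in>primes_upto N. ln (real p) / (real p - 1)) = mertens_sum N + (\<Sum>p\<in>primes_upto N. f p)"
      unfolding mertens_sum_def sum.distrib[symmetric]
    proof (intro sum.cong refl)
      fix p assume "p \<in> primes_upto N"
      hence "real p > 1" using prime_gt_1_nat by (auto simp: primes_upto_def)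
      hence "real p - 1 \<noteq> 0" "real p + 1 \<noteq> 0" by auto
      thus "ln (real p) / (real p - 1) = ln (real p) / (real p + 1) + f p"
        unfolding f_def by (simp add: divide_simps) (simp add: algebra_simps)
    qed
    also have "(\<Sum>p\<in>primes_upto N. f p) \<le> suminf f" by (intro sum_le_suminf sf) (auto simp: nn)
    finally have "ln (real N) - 1 \<le> mertens_sum N + suminf f"
      using sum_ln_prime_over_pred_ge[of N] N by simp
    thus ?thesis using up K4 unfolding K_def by linarith
  qed
  thus ?thesis using that[of K] K4 K_def by simp
qed

lemma mertens_sum_mono: "M \<le> N \<Longrightarrow> mertens_sum M \<le> mertens_sum N"
  unfolding mertens_sum_def
  by (intro sum_mono2) (auto simp: primes_upto_def dest: prime_gt_0_nat)

lemma mertens_sum_nonneg: "mertens_sum N \<ge> 0"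
  unfolding mertens_sum_def by (intro sum_nonneg) (auto simp: primes_upto_def dest: prime_gt_0_nat)

lemma mertens_sum_Suc:
  "mertens_sum (Suc N) = mertens_sum N + (if prime (Suc N) then ln (real (Suc N)) / (real (Suc N) + 1) else 0)"
  by (simp add: mertens_sum_def primes_upto_Suc) (simp add: primes_upto_def)

section \<open>Lower bound for the product of \<open>1 + 1 / p\<close>\<close>

lemma squarefree_eq_prod_prime_factors:
  assumes "squarefree (m :: nat)"
  shows "m = \<Prod>(prime_factors m)"
proof -
  have m: "m \<noteq> 0" using assms by (metis not_squarefree_0)
  have "m = (\<Prod>p\<in>prime_factors m. p ^ multiplicity p m)" using m by (intro prime_factorization_nat) simp
  also have "\<dots> = (\<Prod>p\<in>prime_factors m. p)"
    using assms squarefree_factorial_semiring'[OF m] by (intro prod.cong) auto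
  finally show ?thesis by simp
qed

lemma sum_inverse_squares_le: "(\<Sum>b\<in>{1..N}. 1 / real b ^ 2) \<le> 2"
proof -
  have "(\<Sum>b\<in>{1..N}. 1 / real b ^ 2) \<le> 2 - 1 / real N"
  proof (induction N)
    case (Suc N)
    show ?case
    proof (cases "N = 0")
      case False
      have "1 / real (Suc N) ^ 2 \<le> 1 / real N - 1 / real (Suc N)"
      proof -
        have "1 / real (Suc N) ^ 2 \<le> 1 / (real N * real (Suc N))"
          using False by (intro divide_left_mono) (auto simp: power2_eq_square)
        also have "\<dots> = 1 / real N - 1 / real (Suc N)" using False by (simp add: field_simps)
        finally show ?thesis .
      qed
      thus ?thesis using Suc False by simp
    qed simp
  qed simp
  also have "\<dots> \<le> 2" by simp
  finally show ?thesis .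
qed

text \<open>Encoding \<open>n\<close> by the primes of its squarefree part and by its square part
  \<open>b\<close> is injective. The harmonic sum is therefore at most the expanded product times
  the sum of \<open>1 / b^2\<close>, which is at most 2.\<close>

lemma prod_primes_ge_ln:
  assumes "N \<ge> 1"
  shows "ln (real N) \<le> 2 * (\<Prod>p\<in>primes_upto N. 1 + 1 / real p)"
proof -
  let ?A = "primes_upto N"
  define g where "g = (\<lambda>n::nat. (prime_factors (squarefree_part n), square_part n))"
  define w where "w = (\<lambda>(X::nat set, b::nat). (\<Prod>p\<in>X. 1 / real p) * (1 / real b ^ 2))"
  have dec: "n = \<Prod>(prime_factors (squarefree_part n)) * square_part n ^ 2" for n :: nat
    using squarefree_decompose[of n] squarefree_eq_prod_prime_factors[of "squarefree_part n"] by simp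
  have inj: "inj_on g {1..N}"
  proof (intro inj_onI)
    fix m n assume "g m = g n"
    hence "prime_factors (squarefree_part m) = prime_factors (squarefree_part n)"
      "square_part m = square_part n" by (auto simp: g_def)
    thus "m = n" using dec[of m] dec[of n] by simp
  qed
  have img: "g ` {1..N} \<subseteq> Pow ?A \<times> {1..N}"
  proof
    fix z assume "z \<in> g ` {1..N}"
    then obtain n where n: "n \<in> {1..N}" "z = g n" by auto
    have sp: "squarefree_part n dvd n" "square_part n dvd n"
      using squarefree_decompose[of n] 
      by (metis dvd_triv_left, metis dvd_mult_left dvd_triv_right power2_eq_square)
    have "p \<in> ?A" if "p \<in> prime_factors (squarefree_part n)" for p
    proof -
      have "p dvd n" "prime p" using that sp by (auto intro: dvd_trans)
      thus ?thesis using n dvd_imp_le[of p n] by (auto simp: primes_upto_def)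
    qed
    moreover have "square_part n \<in> {1..N}"
      using sp n dvd_imp_le[of "square_part n" n] square_part_0_iff[of n]
      by (metis atLeastAtMost_iff le_trans less_one not_le)
    ultimately show "z \<in> Pow ?A \<times> {1..N}" using n by (auto simp: g_def)
  qed
  have "ln (real N) \<le> ln (real N + 1)" using assms by simp
  also have "\<dots> \<le> harm N" by (rule ln_le_harm)
  also have "harm N = (\<Sum>n\<in>{1..N}. w (g n))"
    unfolding harm_def
  proof (intro sum.cong refl)
    fix n assume "n \<in> {1..N}"
    have "real n = (\<Prod>p\<in>prime_factors (squarefree_part n). real p) * real (square_part n) ^ 2"
      by (subst dec[of n]) simp
    thus "inverse (of_nat n) = w (g n)"
      by (simp add: w_def g_def prod_dividef divide_simps)
  qed
  also have "\<dots> = sum w (g ` {1..N})" using inj by (simp add: sum.reindex)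
  also have "\<dots> \<le> sum w (Pow ?A \<times> {1..N})"
    using img by (intro sum_mono2) (auto simp: w_def intro!: mult_nonneg_nonneg prod_nonneg divide_nonneg_nonneg)
  also have "\<dots> = (\<Sum>X\<in>Pow ?A. \<Prod>p\<in>X. 1 / real p) * (\<Sum>b\<in>{1..N}. 1 / real b ^ 2)"
    by (simp add: w_def sum_product sum.cartesian_product)
  also have "(\<Sum>X\<in>Pow ?A. \<Prod>p\<in>X. 1 / real p) = (\<Prod>p\<in>?A. 1 / real p + 1)"
    by (subst prod_add) auto
  also have "\<dots> * (\<Sum>b\<in>{1..N}. 1 / real b ^ 2) \<le> (\<Prod>p\<in>?A. 1 / real p + 1) * 2"
    by (intro mult_left_mono sum_inverse_squares_le prod_nonneg) auto
  finally show ?thesis by (simp add: algebra_simps)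
qed

subsection \<open>Squarefree practical numbers\<close>

text \<open>For squarefree numbers \<open>S_phi_star n = n\<close> holds automatically; including it in the
  definition lets closure under multiplication by primes carry it along.\<close>

definition sqfree_practical :: "nat set" where
  "sqfree_practical = {n. squarefree n \<and> phi_star_practical n \<and> S_phi_star n = n}"

lemma phi_star_1 [simp]: "phi_star (Suc 0) = 1"
  by (simp add: phi_star_def)

lemma S_phi_star_1 [simp]: "S_phi_star (Suc 0) = 1"
  by (simp add: S_phi_star_def)

lemma one_in_sqfree_practical: "1 \<in> sqfree_practical"
proof -
  have "phi_star_practical 1"
    unfolding phi_star_practical_def
  proof (intro conjI allI impI)
    fix m :: nat assume "0 < m \<and> m \<le> S_phi_star 1"
    hence "m = (\<Sum>d\<in>{1}. phi_star d)" by simp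
    thus "\<exists>D. D \<subseteq> {d. d dvd 1} \<and> m = (\<Sum>d\<in>D. phi_star d)" by (intro exI[of _ "{1}"]) auto
  qed simp
  thus ?thesis by (simp add: sqfree_practical_def)
qed

lemma sqfree_practical_pos: "n \<in> sqfree_practical \<Longrightarrow> n > 0"
  by (simp add: sqfree_practical_def phi_star_practical_def)

lemma phi_star_prime_mult:
  assumes "prime p" "\<not> p dvd d" "d > 0"
  shows "phi_star (p * d) = (p - 1) * phi_star d"
proof -
  have pf: "prime_factors (p * d) = insert p (prime_factors d)"
    using assms by (simp add: prime_factorization_mult prime_factorization_prime prime_gt_0_nat)
  have "multiplicity p (p * d) = 1"
    using assms by (simp add: prime_elem_multiplicity_mult_distrib not_dvd_imp_multiplicity_0 prime_gt_0_nat)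
  moreover have "multiplicity r (p * d) = multiplicity r d" if "r \<in> prime_factors d" for r
  proof -
    have "r \<noteq> p" "prime r" using that assms by auto
    hence "multiplicity r p = 0" using assms by (simp add: prime_multiplicity_other)
    thus ?thesis using assms \<open>prime r\<close>
      by (simp add: prime_elem_multiplicity_mult_distrib prime_gt_0_nat)
  qed
  moreover have "p \<notin> prime_factors d" using assms by auto
  ultimately show ?thesis unfolding phi_star_def pf by simp
qed

lemma divisors_prime_mult:
  fixes n p :: nat
  assumes "prime p" "n > 0"
  shows "{d. d dvd p * n} = {d. d dvd n} \<union> (\<lambda>d. p * d) ` {d. d dvd n}"
proof (intro set_eqI iffI)
  fix d assume "d \<in> {d. d dvd p * n}"
  hence d: "d dvd p * n" by simp
  show "d \<in> {d. d dvd n} \<union> (\<lambda>d. p * d) ` {d. d dvd n}"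
  proof (cases "p dvd d")
    case True
    then obtain k where "d = p * k" by blast
    thus ?thesis using d assms prime_gt_0_nat by auto
  next
    case False
    hence "coprime p d" using assms prime_imp_coprime by blast
    hence "d dvd n" using d by (simp add: coprime_commute coprime_dvd_mult_right_iff)
    thus ?thesis by simp
  qed
qed auto

lemma sum_phi_star_mult_image:
  assumes "prime p" "\<not> p dvd n" "n > 0" "D \<subseteq> {d. d dvd n}"
  shows "(\<Sum>d\<in>(\<lambda>d. p * d) ` D. phi_star d) = (p - 1) * (\<Sum>d\<in>D. phi_star d)"
proof -
  have "inj_on (\<lambda>d. p * d) D" using assms prime_gt_0_nat[of p] by (auto simp: inj_on_def)
  hence "(\<Sum>d\<in>(\<lambda>d. p * d) ` D. phi_star d) = (\<Sum>d\<in>D. phi_star (p * d))"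
    by (simp add: sum.reindex)
  also have "\<dots> = (\<Sum>d\<in>D. (p - 1) * phi_star d)"
  proof (intro sum.cong refl phi_star_prime_mult)
    fix d assume "d \<in> D"
    hence "d dvd n" using assms by auto
    thus "\<not> p dvd d" "d > 0" using assms dvd_trans by (blast, metis dvd_pos_nat)
  qed (use assms in auto)
  finally show ?thesis by (simp add: sum_distrib_left)
qed

lemma sum_phi_star_Un_mult_image:
  assumes "prime p" "\<not> p dvd n" "n > 0" "A \<subseteq> {d. d dvd n}" "B \<subseteq> {d. d dvd n}"
  shows "(\<Sum>d\<in>A \<union> (\<lambda>d. p * d) ` B. phi_star d)
       = (\<Sum>d\<in>A. phi_star d) + (p - 1) * (\<Sum>d\<in>B. phi_star d)"
proof -
  have fin: "finite {d. d dvd n}" using assms by simp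
  have "A \<inter> (\<lambda>d. p * d) ` B = {}"
    using assms by (auto dest: dvd_mult_left)
  thus ?thesis
    using sum_phi_star_mult_image[OF assms(1-3,5)] finite_subset[OF assms(4) fin] finite_subset[OF assms(5) fin]
    by (simp add: sum.union_disjoint)
qed

text \<open>Division by \<open>r\<close>, with the quotient capped at \<open>n\<close>. The
  remainder is below \<open>r \<le> n + 1\<close> and so at most \<open>n\<close>; with
  \<open>r = p - 1\<close> this is the source of the condition \<open>p \<le> n + 2\<close>.\<close>

lemma exists_sum_mult_decomposition:
  fixes m n r :: nat
  assumes "r > 0" "r \<le> n + 1" "m \<le> n + r * n"
  obtains a b where "a \<le> n" "b \<le> n" "m = a + r * b"
proof (cases "m div r \<le> n")
  case True
  have "m mod r < r" using assms by simp
  hence "m mod r \<le> n" using assms by linarith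
  thus ?thesis using True that[of "m mod r" "m div r"] by simp
next
  case False
  hence "r * n \<le> r * (m div r)" by simp
  also have "\<dots> \<le> m" by simp
  finally show ?thesis using assms that[of "m - r * n" n] by simp
qed

text \<open>The divisors \<open>d\<close> and \<open>p * d\<close> of \<open>p * n\<close> carry the
  values \<open>phi_star d\<close> and \<open>(p - 1) * phi_star d\<close>. Hence
  \<open>a + (p - 1) * b\<close> is representable whenever \<open>a\<close> and \<open>b\<close> are
  representable over \<open>n\<close>.\<close>

lemma sqfree_practical_mult_prime:
  assumes "n \<in> sqfree_practical" "prime p" "\<not> p dvd n" "p \<le> n + 2"
  shows "p * n \<in> sqfree_practical"
proof -
  have n: "n > 0" "squarefree n" "S_phi_star n = n" "phi_star_practical n"
    using assms sqfree_practical_pos by (auto simp: sqfree_practical_def)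
  have p: "p > 1" using assms prime_gt_1_nat by auto
  have rep: "\<exists>D. D \<subseteq> {d. d dvd n} \<and> m = (\<Sum>d\<in>D. phi_star d)" if "m \<le> n" for m
  proof (cases "m = 0")
    case True
    thus ?thesis by (intro exI[of _ "{}"]) auto
  next
    case False
    thus ?thesis using n that by (auto simp: phi_star_practical_def)
  qed
  have "S_phi_star (p * n) = n + (p - 1) * n"
    unfolding S_phi_star_def divisors_prime_mult[OF assms(2) n(1)]
    by (subst sum_phi_star_Un_mult_image[OF assms(2,3) n(1)]) (use n in \<open>auto simp: S_phi_star_def\<close>)
  also have "\<dots> = p * n" using p by (cases p) auto
  finally have S: "S_phi_star (p * n) = p * n" .
  have "phi_star_practical (p * n)"
    unfolding phi_star_practical_def S
  proof (intro conjI allI impI)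
    fix m assume "0 < m \<and> m \<le> p * n"
    hence "m \<le> n + (p - 1) * n" using p by (cases p) auto
    moreover have "p - 1 > 0" "p - 1 \<le> n + 1" using p assms by auto
    ultimately obtain a b where ab: "a \<le> n" "b \<le> n" "m = a + (p - 1) * b"
      using exists_sum_mult_decomposition[of "p - 1" n m] by blast
    obtain A where A: "A \<subseteq> {d. d dvd n}" "a = (\<Sum>d\<in>A. phi_star d)" using rep ab by blast
    obtain B where B: "B \<subseteq> {d. d dvd n}" "b = (\<Sum>d\<in>B. phi_star d)" using rep ab by blast
    have "m = (\<Sum>d\<in>A \<union> (\<lambda>d. p * d) ` B. phi_star d)"
      using ab A B sum_phi_star_Un_mult_image[OF assms(2,3) n(1) A(1) B(1)] by simp
    moreover have "A \<union> (\<lambda>d. p * d) ` B \<subseteq> {d. d dvd p * n}"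
      using A B divisors_prime_mult[OF assms(2) n(1)] by blast
    ultimately show "\<exists>D. D \<subseteq> {d. d dvd p * n} \<and> m = (\<Sum>d\<in>D. phi_star d)" by blast
  qed (use n p in auto)
  moreover have "squarefree (p * n)"
    using n assms by (intro squarefree_mult_coprime) (auto intro: squarefree_prime prime_imp_coprime)
  ultimately show ?thesis using S by (simp add: sqfree_practical_def)
qed

subsection \<open>Multiplication by primes of comparable size\<close>

text \<open>The primes between \<open>N^(3/4)\<close> and \<open>N\<close>, written with integer
  powers. The exponent 3/4 is what makes \<open>2 * J\<close> such factors enough in
  \<open>practical_count_large\<close>.\<close>

definition mid_primes :: "nat \<Rightarrow> nat set" where
  "mid_primes N = {p. prime p \<and> p \<le> N \<and> N ^ 3 < p ^ 4}"

lemma mid_primes_subset: "mid_primes N \<subseteq> primes_upto N"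
  by (auto simp: mid_primes_def primes_upto_def)

lemma finite_mid_primes [simp, intro]: "finite (mid_primes N)"
  using mid_primes_subset finite_primes_upto finite_subset by blast

lemma ln_mid_prime_ge:
  assumes "p \<in> mid_primes N" "N \<ge> 1"
  shows "3 / 4 * ln (real N) \<le> ln (real p)"
proof -
  have "real N ^ 3 \<le> real p ^ 4"
    using assms by (metis (mono_tags, lifting) mem_Collect_eq mid_primes_def of_nat_le_iff of_nat_power less_imp_le)
  hence "ln (real N ^ 3) \<le> ln (real p ^ 4)" using assms by (subst ln_le_cancel_iff) (auto simp: mid_primes_def prime_gt_0_nat)
  thus ?thesis using assms prime_gt_0_nat[of p] by (simp add: ln_realpow mid_primes_def)
qed

lemma card_mid_primes_dvd:
  assumes "k > 0" "N \<ge> 2"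
  shows "real (card {p\<in>mid_primes N. p dvd k}) * ln (real N) \<le> 2 * ln (real k)"
proof -
  have "real (card {p\<in>mid_primes N. p dvd k}) * (3 / 4 * ln (real N)) \<le> ln (real k)"
    using assms ln_mid_prime_ge[of _ N] by (intro card_primes_dvd_le) (auto simp: mid_primes_def)
  moreover have "ln (real k) \<ge> 0" using assms by simp
  ultimately show ?thesis by simp
qed

text \<open>Between \<open>N^(3/4)\<close> and \<open>N\<close> the sum \<open>mertens_sum\<close>
  grows by at least \<open>ln N / 4 - 2K\<close>, which is at least \<open>ln N / 8\<close> once
  \<open>ln N \<ge> 16K\<close>. Dividing by \<open>ln N\<close>, an upper bound for each
  \<open>ln p\<close>, leaves 1/8.\<close>

lemma sum_inverse_mid_primes:
  obtains N0 where "\<And>N. N \<ge> N0 \<Longrightarrow> (\<Sum>p\<in>mid_primes N. 1 / real p) \<ge> 1 / 8"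
proof -
  obtain K where K: "K \<ge> 0" "\<And>N. N \<ge> 1 \<Longrightarrow> \<bar>mertens_sum N - ln (real N)\<bar> \<le> K"
    using mertens_sum_bound by blast
  have "eventually (\<lambda>N::nat. ln (real N) \<ge> 16 * K + 1) at_top" by real_asymp
  then obtain N0 where N0: "\<And>N. N \<ge> N0 \<Longrightarrow> ln (real N) \<ge> 16 * K + 1"
    by (auto simp: eventually_at_top_linorder)
  have "(\<Sum>p\<in>mid_primes N. 1 / real p) \<ge> 1 / 8" if "N \<ge> max 2 N0" for N
  proof -
    have N: "N \<ge> 2" "ln (real N) \<ge> 16 * K + 1" using that N0 by auto
    define M where "M = nat \<lfloor>real N powr (3/4)\<rfloor>"
    have p1: "real N powr (3/4) \<ge> 1" using N by (intro ge_one_powr_ge_zero) auto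
    have pN: "real N powr (3/4) \<le> real N powr 1" using N by (intro powr_mono) auto
    have M: "M \<ge> 1" "real M \<le> real N powr (3/4)" "real N powr (3/4) < real M + 1"
      unfolding M_def using p1 by linarith+
    have MN: "M \<le> N" using M pN N by simp
    have sub: "primes_upto N - primes_upto M \<subseteq> mid_primes N"
    proof
      fix p assume "p \<in> primes_upto N - primes_upto M"
      hence p: "prime p" "p \<le> N" "p > M" by (auto simp: primes_upto_def)
      hence "real N powr (3/4) < real p" using M by linarith
      hence "(real N powr (3/4)) ^ 4 < real p ^ 4" by (intro power_strict_mono) auto
      also have "(real N powr (3/4)) ^ 4 = real N ^ 3"
        using N by (simp add: powr_powr flip: powr_numeral)
      finally have "N ^ 3 < p ^ 4" by (metis of_nat_less_iff of_nat_power)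
      thus "p \<in> mid_primes N" using p by (simp add: mid_primes_def)
    qed
    have "ln (real M) \<le> ln (real N powr (3/4))" using M N by (subst ln_le_cancel_iff) auto
    hence lM: "ln (real M) \<le> 3/4 * ln (real N)" by (simp add: ln_powr)
    have "ln (real N) / 8 \<le> mertens_sum N - mertens_sum M"
      using K(2)[of N] K(2)[of M] M(1) N lM by (simp add: abs_le_iff)
    also have "\<dots> = (\<Sum>p\<in>primes_upto N - primes_upto M. ln (real p) / (real p + 1))"
      unfolding mertens_sum_def using MN by (subst sum_diff) (auto simp: primes_upto_def)
    also have "\<dots> \<le> (\<Sum>p\<in>mid_primes N. ln (real p) / (real p + 1))"
      using sub by (intro sum_mono2) (auto simp: mid_primes_def dest: prime_gt_0_nat)
    also have "\<dots> \<le> (\<Sum>p\<in>mid_primes N. ln (real N) * (1 / real p))"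
    proof (intro sum_mono)
      fix p assume "p \<in> mid_primes N"
      hence p: "p > 0" "p \<le> N" by (auto simp: mid_primes_def prime_gt_0_nat)
      have "ln (real p) / (real p + 1) \<le> ln (real N) / real p"
        using p by (intro frac_le) auto
      thus "ln (real p) / (real p + 1) \<le> ln (real N) * (1 / real p)" by simp
    qed
    also have "\<dots> = ln (real N) * (\<Sum>p\<in>mid_primes N. 1 / real p)" by (simp add: sum_distrib_left)
    finally have "ln (real N) * (1 / 8) \<le> ln (real N) * (\<Sum>p\<in>mid_primes N. 1 / real p)" by simp
    moreover have "ln (real N) > 0" using N by simp
    ultimately show ?thesis by (simp only: mult_le_cancel_left_pos)
  qed
  thus ?thesis using that by blast
qed

text \<open>A product \<open>k = p * n\<close> together with \<open>p\<close> determines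
  \<open>n\<close>, so \<open>k\<close> arises from at most as many pairs as it has divisors in
  \<open>Q\<close>.\<close>

lemma sum_pairs_le:
  fixes S :: "(nat \<times> nat) set" and g :: "nat \<Rightarrow> real"
  assumes "finite S" "finite Q" "\<And>n p. (n, p) \<in> S \<Longrightarrow> p \<in> Q" "0 \<notin> Q" "\<And>k. g k \<ge> 0"
  shows "(\<Sum>(n, p)\<in>S. g (p * n)) \<le> (\<Sum>k\<in>(\<lambda>(n, p). p * n) ` S. real (card {p\<in>Q. p dvd k}) * g k)"
proof -
  let ?h = "\<lambda>(n, p). p * n"
  have "(\<Sum>(n, p)\<in>S. g (p * n)) = (\<Sum>z\<in>S. g (?h z))" by (simp add: case_prod_unfold)
  also have "\<dots> = (\<Sum>k\<in>?h ` S. \<Sum>z\<in>{z\<in>S. ?h z = k}. g (?h z))"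
    by (rule sum.image_gen) fact
  also have "\<dots> \<le> (\<Sum>k\<in>?h ` S. real (card {p\<in>Q. p dvd k}) * g k)"
  proof (intro sum_mono)
    fix k
    have "card {z\<in>S. ?h z = k} \<le> card {p\<in>Q. p dvd k}"
    proof (rule card_inj_on_le)
      show "inj_on snd {z\<in>S. ?h z = k}"
      proof (rule inj_onI)
        fix y z assume "y \<in> {z\<in>S. ?h z = k}" "z \<in> {z\<in>S. ?h z = k}" "snd y = snd z"
        then obtain a b c where *: "y = (a, b)" "z = (c, b)" "(a, b) \<in> S" "b * a = b * c"
          by (cases y, cases z) auto
        hence "b \<noteq> 0" using assms by metis
        thus "y = z" using * by simp
      qed
      show "snd ` {z\<in>S. ?h z = k} \<subseteq> {p\<in>Q. p dvd k}" using assms by auto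
      show "finite {p\<in>Q. p dvd k}" using assms by simp
    qed
    hence "real (card {z\<in>S. ?h z = k}) * g k \<le> real (card {p\<in>Q. p dvd k}) * g k"
      using assms by (intro mult_right_mono) auto
    moreover have "(\<Sum>z\<in>{z\<in>S. ?h z = k}. g (?h z)) = (\<Sum>z\<in>{z\<in>S. ?h z = k}. g k)"
      by (intro sum.cong) auto
    ultimately show "(\<Sum>z\<in>{z\<in>S. ?h z = k}. g (?h z)) \<le> real (card {p\<in>Q. p dvd k}) * g k" by simp
  qed
  finally show ?thesis .
qed

text \<open>The multiplicity \<open>card {p\<in>mid_primes N. p dvd k}\<close> of \<open>k\<close> as a product \<open>p * n\<close> is bounded
  as long as \<open>k\<close> is bounded by a fixed power of \<open>N\<close>, since mid primes exceed \<open>N\<close> to the power \<open>3/4\<close>.\<close>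

definition mid_extension :: "nat \<Rightarrow> nat set \<Rightarrow> nat set" where
  "mid_extension N B = {p * n | n p. n \<in> B \<and> p \<in> mid_primes N \<and> \<not> p dvd n}"

text \<open>At most \<open>2L\<close> mid primes divide a given \<open>n \<le> N^L\<close>, and each
  of them exceeds \<open>32L\<close>, so leaving them out costs at most 1/16 of the total 1/8 from
  \<open>sum_inverse_mid_primes\<close>.\<close>

lemma mid_extension_reciprocal_sum:
  obtains N0 where "\<And>N B. N \<ge> N0 \<Longrightarrow> finite B \<Longrightarrow> (\<And>n. n \<in> B \<Longrightarrow> 0 < n \<and> n \<le> N ^ L) \<Longrightarrow>
    (\<Sum>n\<in>B. 1 / real n) \<le>
      16 * (\<Sum>k\<in>mid_extension N B. real (card {p\<in>mid_primes N. p dvd k}) * (1 / real k))"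
proof -
  obtain N1 where N1: "\<And>N. N \<ge> N1 \<Longrightarrow> (\<Sum>p\<in>mid_primes N. 1 / real p) \<ge> 1 / 8"
    using sum_inverse_mid_primes by blast
  \<comment> \<open>With \<open>N \<ge> (32L + 1)^2\<close>, a prime above \<open>N^(3/4)\<close> is
    larger than \<open>32L\<close>.\<close>
  define N0 where "N0 = N1 + 2 + (32 * L + 1) ^ 2"
  have "(\<Sum>n\<in>B. 1 / real n) \<le>
      16 * (\<Sum>k\<in>mid_extension N B. real (card {p\<in>mid_primes N. p dvd k}) * (1 / real k))"
    if "N \<ge> N0" "finite B" and B: "\<And>n. n \<in> B \<Longrightarrow> 0 < n \<and> n \<le> N ^ L" for N B
  proof -
    have N: "N \<ge> N1" "N \<ge> 2" "N \<ge> (32 * L + 1) ^ 2" using that by (auto simp: N0_def)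
    have big: "p > 32 * L" if "p \<in> mid_primes N" for p
    proof (rule ccontr)
      assume "\<not> p > 32 * L"
      hence "p ^ 4 \<le> (32 * L + 1) ^ 4" by (intro power_mono) auto
      also have "\<dots> \<le> ((32 * L + 1) ^ 2) ^ 3" unfolding power_mult[symmetric]
        by (intro power_increasing) auto
      also have "\<dots> \<le> N ^ 3" using N by (intro power_mono) auto
      finally show False using that by (simp add: mid_primes_def)
    qed
    have low: "1 / 16 \<le> (\<Sum>p\<in>{p\<in>mid_primes N. \<not> p dvd n}. 1 / real p)" if n: "n \<in> B" for n
    proof -
      let ?D = "{p\<in>mid_primes N. p dvd n}"
      have np: "n > 0" "real n \<le> real N ^ L" using B[OF n] by (auto simp flip: of_nat_power)
      have "real (card ?D) * ln (real N) \<le> 2 * ln (real n)"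
        using np N by (intro card_mid_primes_dvd) auto
      also have "ln (real n) \<le> ln (real N ^ L)" using np N by (subst ln_le_cancel_iff) auto
      also have "\<dots> = real L * ln (real N)" using N by (simp add: ln_realpow)
      finally have "real (card ?D) * ln (real N) \<le> (2 * real L) * ln (real N)" by simp
      hence card: "real (card ?D) \<le> 2 * real L" using N by simp
      have "(\<Sum>p\<in>?D. 1 / real p) \<le> (\<Sum>p\<in>?D. 1 / (32 * real L + 1))"
      proof (intro sum_mono divide_left_mono)
        fix p assume "p \<in> ?D"
        hence "p > 32 * L" using big by auto
        hence p: "32 * real L + 1 \<le> real p" by linarith
        thus "32 * real L + 1 \<le> real p" .
        show "0 < real p * (32 * real L + 1)" using p by (intro mult_pos_pos) linarith+
      qed simp
      also have "\<dots> \<le> (2 * real L) / (32 * real L + 1)"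
        using card by (simp add: divide_right_mono)
      also have "\<dots> \<le> 1 / 16" by (simp add: field_simps)
      finally have "(\<Sum>p\<in>?D. 1 / real p) \<le> 1 / 16" .
      moreover have "(\<Sum>p\<in>mid_primes N. 1 / real p) = (\<Sum>p\<in>?D. 1 / real p) + (\<Sum>p\<in>{p\<in>mid_primes N. \<not> p dvd n}. 1 / real p)"
        by (subst sum.union_disjoint[symmetric]) (auto intro!: sum.cong)
      ultimately show ?thesis using N1[OF N(1)] by linarith
    qed
    define S where "S = (SIGMA n:B. {p\<in>mid_primes N. \<not> p dvd n})"
    have finS: "finite S" unfolding S_def using that by auto
    have ext: "(\<lambda>(n, p). p * n) ` S = mid_extension N B"
      by (force simp: S_def mid_extension_def image_iff)
    have "(\<Sum>n\<in>B. 1 / real n) \<le> (\<Sum>n\<in>B. 16 * ((\<Sum>p\<in>{p\<in>mid_primes N. \<not> p dvd n}. 1 / real p) * (1 / real n)))"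
    proof (intro sum_mono)
      fix n assume "n \<in> B"
      have "1 / 16 * (1 / real n) \<le> (\<Sum>p\<in>{p\<in>mid_primes N. \<not> p dvd n}. 1 / real p) * (1 / real n)"
        using low[OF \<open>n \<in> B\<close>] by (intro mult_right_mono) auto
      thus "1 / real n \<le> 16 * ((\<Sum>p\<in>{p\<in>mid_primes N. \<not> p dvd n}. 1 / real p) * (1 / real n))" by simp
    qed
    also have "\<dots> = 16 * (\<Sum>n\<in>B. \<Sum>p\<in>{p\<in>mid_primes N. \<not> p dvd n}. 1 / real (p * n))"
      by (simp add: sum_distrib_left sum_distrib_right sum_divide_distrib)
    also have "\<dots> = 16 * (\<Sum>(n, p)\<in>S. 1 / real (p * n))"
      unfolding S_def using that by (subst sum.Sigma) auto
    also have "(\<Sum>(n, p)\<in>S. 1 / real (p * n)) \<le>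
        (\<Sum>k\<in>(\<lambda>(n, p). p * n) ` S. real (card {p\<in>mid_primes N. p dvd k}) * (1 / real k))"
      by (rule sum_pairs_le[where g = "\<lambda>k. 1 / real k"]) (use finS in \<open>auto simp: S_def mid_primes_def\<close>)
    finally show ?thesis unfolding ext by simp
  qed
  thus ?thesis using that by blast
qed

subsection \<open>The stopped process\<close>

text \<open>\<open>m0_ge\<close> says that \<open>m0\<close> is not yet stopped before the starting
  time \<open>q\<close>, \<open>m0_primes\<close> that every later prime is new to it, and
  \<open>ln_m0_ge\<close> that the martingale, lowered by \<open>K\<close>, starts at a value of at
  least 1.\<close>

locale dense_process =
  fixes q m0 :: nat and K :: real
  assumes q_ge_1: "q \<ge> 1"
    and K_nonneg: "K \<ge> 0"
    and mertens: "\<And>N. N \<ge> 1 \<Longrightarrow> \<bar>mertens_sum N - ln (real N)\<bar> \<le> K"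
    and m0_practical: "m0 \<in> sqfree_practical"
    and m0_ge: "q \<le> m0"
    and m0_primes: "\<And>p. prime p \<Longrightarrow> p dvd m0 \<Longrightarrow> p \<le> q"
    and ln_m0_ge: "ln (real m0) \<ge> mertens_sum q + K + 1"
begin

text \<open>\<open>survivors N\<close> consists of the \<open>N\<close>-smooth numbers built from \<open>m0\<close> that have not been stopped: when the
  process reaches \<open>Suc N\<close>, only the element \<open>N\<close> itself can be stopped, as all elements are at least \<open>N\<close>.\<close>

primrec survivors :: "nat \<Rightarrow> nat set" where
  "survivors 0 = {m0}"
| "survivors (Suc N) = (if N < q then {m0}
     else if prime (Suc N) then {n\<in>survivors N. N < n} \<union> (\<lambda>n. Suc N * n) ` {n\<in>survivors N. N < n}
     else {n\<in>survivors N. N < n})"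

lemma survivors_init: "N \<le> q \<Longrightarrow> survivors N = {m0}"
  by (cases N) auto

lemma survivors_Suc:
  "N \<ge> q \<Longrightarrow> survivors (Suc N) = (if prime (Suc N) then {n\<in>survivors N. N < n} \<union> (\<lambda>n. Suc N * n) ` {n\<in>survivors N. N < n}
     else {n\<in>survivors N. N < n})"
  by simp

lemma survivors_Suc_cases:
  assumes "N \<ge> q" "n \<in> survivors (Suc N)"
  obtains "n \<in> survivors N" "N < n" | k where "prime (Suc N)" "n = Suc N * k" "k \<in> survivors N" "N < k"
proof (cases "n \<in> survivors N \<and> N < n")
  case False
  hence "prime (Suc N)" "n \<in> (\<lambda>n. Suc N * n) ` {n\<in>survivors N. N < n}"
    using assms unfolding survivors_Suc[OF assms(1)] by (auto split: if_splits)
  thus ?thesis using that(2) by blast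
qed (use that in blast)

lemma finite_survivors [simp, intro]: "finite (survivors N)"
  by (induction N) auto

text \<open>An element that is not stopped satisfies \<open>N < n\<close>, so the next prime
  \<open>Suc N\<close> is at most \<open>n\<close> and falls under
  \<open>sqfree_practical_mult_prime\<close>.\<close>

lemma survivors_props:
  assumes "N \<ge> q" "n \<in> survivors N"
  shows "N \<le> n" "n \<in> sqfree_practical" "\<And>p. prime p \<Longrightarrow> p dvd n \<Longrightarrow> p \<le> N"
proof -
  have "\<forall>n\<in>survivors N. N \<le> n \<and> n \<in> sqfree_practical \<and> (\<forall>p. prime p \<longrightarrow> p dvd n \<longrightarrow> p \<le> N)"
    using assms(1)
  proof (induction N rule: nat_induct_at_least)
    case base
    thus ?case using m0_practical m0_ge m0_primes by (auto simp: survivors_init)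
  next
    case (Suc N)
    show ?case
    proof
      fix n assume "n \<in> survivors (Suc N)"
      from survivors_Suc_cases[OF Suc.hyps this] show "Suc N \<le> n \<and> n \<in> sqfree_practical \<and> (\<forall>p. prime p \<longrightarrow> p dvd n \<longrightarrow> p \<le> Suc N)"
      proof cases
        case 1
        thus ?thesis using Suc.IH by (auto intro: le_SucI)
      next
        case (2 k)
        have "\<not> Suc N dvd k" using Suc.IH 2 by (meson Suc_n_not_le_n)
        hence "Suc N * k \<in> sqfree_practical"
          using 2 Suc.IH by (intro sqfree_practical_mult_prime) auto
        moreover have "p \<le> Suc N" if "prime p" "p dvd Suc N * k" for p
        proof -
          have "p dvd Suc N \<or> p dvd k" using that by (simp only: prime_dvd_mult_iff)
          thus ?thesis using Suc.IH 2 that dvd_imp_le[of p "Suc N"] by (auto intro: le_SucI)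
        qed
        moreover have "Suc N \<le> Suc N * k" using 2 by (cases k) auto
        ultimately show ?thesis using 2 by blast
      qed
    qed
  qed
  thus "N \<le> n" "n \<in> sqfree_practical" "\<And>p. prime p \<Longrightarrow> p dvd n \<Longrightarrow> p \<le> N" using assms by auto
qed

lemma survivors_pos: "N \<ge> q \<Longrightarrow> n \<in> survivors N \<Longrightarrow> n > 0"
  using survivors_props(1)[of N n] q_ge_1 by linarith

lemma Suc_not_dvd_survivors: "N \<ge> q \<Longrightarrow> n \<in> survivors N \<Longrightarrow> prime (Suc N) \<Longrightarrow> \<not> Suc N dvd n"
  using survivors_props(3)[of N n "Suc N"] by (meson Suc_n_not_le_n)

text \<open>An extra prime factor makes every later stage larger and so cannot cause stopping. This
  provides the map from small to large survivors.\<close>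

lemma survivors_mult_prime:
  assumes "N \<ge> q" "n \<in> survivors N" "prime p" "q < p" "p \<le> N" "\<not> p dvd n"
  shows "p * n \<in> survivors N"
  using assms
proof (induction N arbitrary: n rule: nat_induct_at_least)
  case base
  thus ?case by simp
next
  case (Suc N)
  have p1: "p \<ge> 1" using Suc.prems by simp
  from survivors_Suc_cases[OF Suc.hyps Suc.prems(1)] show ?case
  proof cases
    case 1
    show ?thesis
    proof (cases "p = Suc N")
      case True
      thus ?thesis using 1 Suc.hyps Suc.prems by (simp add: survivors_Suc del: mult_Suc survivors.simps)
    next
      case False
      hence "p * n \<in> survivors N" using Suc.IH[of n] Suc.prems 1 by simp
      moreover have "N < p * n" using 1 p1 by (metis less_le_trans mult_le_mono1 nat_mult_1)
      ultimately show ?thesis using Suc.hyps by (simp add: survivors_Suc del: survivors.simps)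
    qed
  next
    case (2 k)
    have "p \<noteq> Suc N" "\<not> p dvd k" using Suc.prems 2 by (auto simp del: mult_Suc)
    hence "p * k \<in> survivors N" using Suc.IH[of k] Suc.prems 2 by simp
    moreover have "N < p * k" using 2 p1 by (metis less_le_trans mult_le_mono1 nat_mult_1)
    ultimately have "Suc N * (p * k) \<in> survivors (Suc N)"
      using Suc.hyps 2 by (simp add: survivors_Suc del: survivors.simps mult_Suc)
    thus ?thesis using 2 by (simp only: mult.left_commute)
  qed
qed

section \<open>Weighted means over the survivors\<close>

definition euler_prod :: "nat \<Rightarrow> real" where
  "euler_prod N = (\<Prod>p\<in>primes_upto N - primes_upto q. 1 + 1 / real p)"

lemma euler_prod_pos: "euler_prod N > 0"
  unfolding euler_prod_def by (intro prod_pos) (auto intro: add_pos_nonneg)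

lemma euler_prod_Suc:
  assumes "N \<ge> q"
  shows "euler_prod (Suc N) = (if prime (Suc N) then (1 + 1 / real (Suc N)) * euler_prod N else euler_prod N)"
proof -
  have "Suc N \<notin> primes_upto q" "Suc N \<notin> primes_upto N" using assms by (auto simp: primes_upto_def)
  thus ?thesis by (simp add: euler_prod_def primes_upto_Suc insert_Diff_if)
qed

lemma euler_prod_ge:
  obtains c where "c > 0" "\<And>N. N \<ge> q \<Longrightarrow> c * ln (real N) \<le> euler_prod N"
proof -
  define R where "R = (\<Prod>p\<in>primes_upto q. 1 + 1 / real p)"
  have R: "R > 0" unfolding R_def by (intro prod_pos) (auto intro: add_pos_nonneg)
  have "1 / (2 * R) * ln (real N) \<le> euler_prod N" if "N \<ge> q" for N
  proof -
    have "primes_upto q \<subseteq> primes_upto N" using that by (auto simp: primes_upto_def)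
    hence "(\<Prod>p\<in>primes_upto N. 1 + 1 / real p) = euler_prod N * R"
      unfolding euler_prod_def R_def by (intro prod.subset_diff) auto
    hence "ln (real N) \<le> 2 * (euler_prod N * R)" using prod_primes_ge_ln[of N] that q_ge_1 by simp
    thus ?thesis using R by (simp add: field_simps)
  qed
  thus ?thesis using that[of "1 / (2 * R)"] R by simp
qed

text \<open>Without stopping, the process started at \<open>m0\<close> is at \<open>n\<close> with
  probability \<open>m0 / (n * euler_prod N)\<close>. Hence \<open>wmean f N\<close> is the
  expectation of \<open>f\<close> restricted to survival, divided by \<open>m0\<close>.\<close>

definition wmean :: "(nat \<Rightarrow> real) \<Rightarrow> nat \<Rightarrow> real" where
  "wmean f N = (\<Sum>n\<in>survivors N. f n / real n) / euler_prod N"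

text \<open>Conditional expectation of \<open>f\<close> one step later, given the current element
  \<open>n\<close>.\<close>

definition prime_step_avg :: "nat \<Rightarrow> (nat \<Rightarrow> real) \<Rightarrow> nat \<Rightarrow> real" where
  "prime_step_avg N f n = (if prime (Suc N)
     then (real (Suc N) * f n + f (Suc N * n)) / (real (Suc N) + 1) else f n)"

lemma wmean_mono: "(\<And>n. n \<in> survivors N \<Longrightarrow> f n \<le> g n) \<Longrightarrow> wmean f N \<le> wmean g N"
  unfolding wmean_def using euler_prod_pos[of N] by (intro divide_right_mono sum_mono) auto

lemma wmean_add: "wmean (\<lambda>n. f n + g n) N = wmean f N + wmean g N"
  by (simp add: wmean_def sum.distrib add_divide_distrib)

lemma wmean_scale: "wmean (\<lambda>n. c * f n) N = c * wmean f N"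
  by (simp add: wmean_def sum_distrib_left mult.assoc)

lemma wmean_nonneg: "(\<And>n. n \<in> survivors N \<Longrightarrow> f n \<ge> 0) \<Longrightarrow> wmean f N \<ge> 0"
  unfolding wmean_def using euler_prod_pos[of N] by (intro divide_nonneg_pos sum_nonneg divide_nonneg_nonneg) auto

lemma wmean_q: "wmean f q = f m0 / real m0"
  by (simp add: wmean_def survivors_init euler_prod_def)

text \<open>When \<open>Suc N\<close> is a prime \<open>p\<close>, dividing the weights
  \<open>1 / n\<close> and \<open>1 / (p n)\<close> by the new factor \<open>1 + 1 / p\<close> gives
  \<open>1 / n\<close> times the transition probabilities \<open>p / (p + 1)\<close> and
  \<open>1 / (p + 1)\<close>.\<close>

lemma wmean_Suc:
  assumes "N \<ge> q"
  shows "wmean f (Suc N) = (\<Sum>n\<in>{n\<in>survivors N. N < n}. prime_step_avg N f n / real n) / euler_prod N"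
proof (cases "prime (Suc N)")
  case False
  thus ?thesis using assms by (simp add: wmean_def survivors_Suc euler_prod_Suc prime_step_avg_def del: survivors.simps)
next
  case True
  let ?A = "{n\<in>survivors N. N < n}" and ?p = "Suc N"
  have disj: "?A \<inter> (\<lambda>n. ?p * n) ` ?A = {}"
  proof (intro equals0I, elim IntE imageE)
    fix x n assume "x \<in> ?A" "x = Suc N * n"
    thus False using Suc_not_dvd_survivors[OF assms _ True, of x] by (metis (no_types, lifting) dvd_triv_left mem_Collect_eq)
  qed
  have inj: "inj_on (\<lambda>n. ?p * n) ?A" by (auto simp: inj_on_def simp del: mult_Suc)
  have "(\<Sum>n\<in>survivors ?p. f n / real n) = (\<Sum>n\<in>?A. f n / real n) + (\<Sum>n\<in>?A. f (?p * n) / real (?p * n))"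
    using assms True disj
    by (simp add: survivors_Suc sum.union_disjoint sum.reindex[OF inj] del: survivors.simps mult_Suc of_nat_Suc of_nat_mult)
  also have "\<dots> = (\<Sum>n\<in>?A. (1 + 1 / real ?p) * (prime_step_avg N f n / real n))"
    unfolding sum.distrib[symmetric]
  proof (intro sum.cong refl)
    fix n assume "n \<in> ?A"
    hence n: "real n > 0" using survivors_pos[OF assms] by auto
    define x where "x = real ?p"
    have x: "x > 0" by (simp add: x_def)
    have "prime_step_avg N f n = (x * f n + f (?p * n)) / (x + 1)" using True by (simp add: prime_step_avg_def x_def)
    hence "(1 + 1 / x) * (prime_step_avg N f n / real n) = (1 + 1 / x) * ((x * f n + f (?p * n)) / (x + 1) / real n)"
      by simp
    also have "\<dots> = f n / real n + f (?p * n) / (x * real n)"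
    proof -
      have "1 + 1 / x = (x + 1) / x" using x by (simp add: field_simps)
      moreover have "x + 1 \<noteq> 0" using x by simp
      ultimately have "(1 + 1 / x) * ((x * f n + f (?p * n)) / (x + 1) / real n)
          = (x * f n + f (?p * n)) / (x * real n)" by simp
      also have "\<dots> = f n / real n + f (?p * n) / (x * real n)"
        using x by (simp add: add_divide_distrib)
      finally show ?thesis .
    qed
    finally show "f n / real n + f (?p * n) / real (?p * n) = (1 + 1 / real ?p) * (prime_step_avg N f n / real n)"
      unfolding x_def by (simp only: of_nat_mult)
  qed
  also have "\<dots> = (1 + 1 / real ?p) * (\<Sum>n\<in>?A. prime_step_avg N f n / real n)" by (simp only: sum_distrib_left)
  finally have "wmean f ?p = (1 + 1 / real ?p) * (\<Sum>n\<in>?A. prime_step_avg N f n / real n) / ((1 + 1 / real ?p) * euler_prod N)"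
    using True assms by (simp only: wmean_def euler_prod_Suc if_True)
  moreover have "1 + 1 / real ?p \<noteq> 0" by (metis add_pos_nonneg divide_nonneg_nonneg less_irrefl of_nat_0_le_iff zero_le_one zero_less_one)
  ultimately show ?thesis by simp
qed

lemma survivors_split:
  assumes "N \<ge> q"
  shows "(\<Sum>n\<in>survivors N. f n / real n) = (\<Sum>n\<in>{n\<in>survivors N. N < n}. f n / real n) + (if N \<in> survivors N then f N / real N else 0)"
proof -
  have "survivors N = {n\<in>survivors N. N < n} \<union> (if N \<in> survivors N then {N} else {})"
    using survivors_props(1)[OF assms] by (force simp: le_less)
  hence "(\<Sum>n\<in>survivors N. f n / real n) = (\<Sum>n\<in>{n\<in>survivors N. N < n} \<union> (if N \<in> survivors N then {N} else {}). f n / real n)"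
    by simp
  also have "\<dots> = (\<Sum>n\<in>{n\<in>survivors N. N < n}. f n / real n) + (if N \<in> survivors N then f N / real N else 0)"
    by (subst sum.union_disjoint) auto
  finally show ?thesis .
qed

text \<open>Stopping removes at most the term of \<open>N\<close>, and removing a nonpositive term
  cannot lower the sum. \<open>wmean_Suc_le\<close> is the same comparison with the signs
  reversed.\<close>

lemma wmean_Suc_ge:
  assumes "N \<ge> q" "\<And>n. n \<in> survivors N \<Longrightarrow> f n \<le> prime_step_avg N g n" "f N \<le> 0"
  shows "wmean f N \<le> wmean g (Suc N)"
proof -
  have "(\<Sum>n\<in>survivors N. f n / real n) \<le> (\<Sum>n\<in>{n\<in>survivors N. N < n}. f n / real n)"
    using survivors_split[OF assms(1), of f] assms(3) by (auto simp: divide_le_0_iff)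
  also have "\<dots> \<le> (\<Sum>n\<in>{n\<in>survivors N. N < n}. prime_step_avg N g n / real n)"
    using assms by (intro sum_mono divide_right_mono) auto
  finally show ?thesis
    unfolding wmean_Suc[OF assms(1)] unfolding wmean_def using euler_prod_pos[of N] by (intro divide_right_mono) auto
qed

lemma wmean_Suc_le:
  assumes "N \<ge> q" "\<And>n. n \<in> survivors N \<Longrightarrow> prime_step_avg N g n \<le> f n" "f N \<ge> 0"
  shows "wmean g (Suc N) \<le> wmean f N"
proof -
  have "(\<Sum>n\<in>{n\<in>survivors N. N < n}. prime_step_avg N g n / real n) \<le> (\<Sum>n\<in>{n\<in>survivors N. N < n}. f n / real n)"
    using assms by (intro sum_mono divide_right_mono) auto
  also have "\<dots> \<le> (\<Sum>n\<in>survivors N. f n / real n)"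
    using survivors_split[OF assms(1), of f] assms(3) by auto
  finally show ?thesis
    unfolding wmean_Suc[OF assms(1)] unfolding wmean_def using euler_prod_pos[of N] by (intro divide_right_mono) auto
qed

lemma prime_step_avg_ln:
  assumes "n > 0"
  shows "prime_step_avg N (\<lambda>n. ln (real n) - mertens_sum (Suc N) + c) n = ln (real n) - mertens_sum N + c"
proof (cases "prime (Suc N)")
  case True
  define x where "x = real (Suc N)"
  have x: "x > 0" by (simp add: x_def)
  have ms: "mertens_sum (Suc N) = mertens_sum N + ln x / (x + 1)" using True by (simp add: mertens_sum_Suc x_def)
  have l: "ln (real (Suc N * n)) = ln x + ln (real n)"
    unfolding of_nat_mult x_def using assms by (intro ln_mult_pos) auto
  have "prime_step_avg N (\<lambda>n. ln (real n) - mertens_sum (Suc N) + c) n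
    = (x * (ln (real n) - (mertens_sum N + ln x / (x + 1)) + c) + (ln x + ln (real n) - (mertens_sum N + ln x / (x + 1)) + c)) / (x + 1)"
    unfolding prime_step_avg_def ms l using True by (simp add: x_def)
  also have "\<dots> = ((x + 1) * (ln (real n) - mertens_sum N + c) - (x + 1) * (ln x / (x + 1)) + ln x) / (x + 1)"
    by (simp only: distrib_left distrib_right right_diff_distrib) simp
  also have "\<dots> = ln (real n) - mertens_sum N + c" using x by simp
  finally show ?thesis .
next
  case False
  thus ?thesis by (simp add: prime_step_avg_def mertens_sum_Suc)
qed

text \<open>The martingale identity \<open>prime_step_avg_ln\<close> makes \<open>ln n - mertens_sum N\<close> invariant; the stopped element
  contributes \<open>ln N - mertens_sum N\<close>, whose sign becomes known after shifting by \<open>K\<close> either way.\<close>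

lemma wmean_ln_lower:
  assumes "N \<ge> q"
  shows "1 / real m0 \<le> wmean (\<lambda>n. ln (real n) - mertens_sum N - K) N"
  using assms
proof (induction N rule: nat_induct_at_least)
  case base
  have "1 / real m0 \<le> (ln (real m0) - mertens_sum q - K) / real m0"
    using ln_m0_ge by (intro divide_right_mono) auto
  thus ?case by (simp add: wmean_q)
next
  case (Suc N)
  have "wmean (\<lambda>n. ln (real n) - mertens_sum N - K) N \<le> wmean (\<lambda>n. ln (real n) - mertens_sum (Suc N) - K) (Suc N)"
  proof (rule wmean_Suc_ge[OF Suc.hyps])
    fix n assume "n \<in> survivors N"
    thus "ln (real n) - mertens_sum N - K \<le> prime_step_avg N (\<lambda>n. ln (real n) - mertens_sum (Suc N) - K) n"
      using prime_step_avg_ln[of n N "- K"] survivors_pos[OF Suc.hyps] by simp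
  next
    show "ln (real N) - mertens_sum N - K \<le> 0"
      using mertens[of N] Suc.hyps q_ge_1 by (simp add: abs_le_iff)
  qed
  thus ?case using Suc.IH by simp
qed

section \<open>Upper bounds for the first moment, the mass and the second moment\<close>

definition excess_bound :: real where "excess_bound = (ln (real m0) - mertens_sum q + K) / real m0"

lemma wmean_ln_upper:
  assumes "N \<ge> q"
  shows "wmean (\<lambda>n. ln (real n) - mertens_sum N + K) N \<le> excess_bound"
  using assms
proof (induction N rule: nat_induct_at_least)
  case base
  show ?case by (simp add: wmean_q excess_bound_def)
next
  case (Suc N)
  have "wmean (\<lambda>n. ln (real n) - mertens_sum (Suc N) + K) (Suc N) \<le> wmean (\<lambda>n. ln (real n) - mertens_sum N + K) N"
  proof (rule wmean_Suc_le[OF Suc.hyps])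
    fix n assume "n \<in> survivors N"
    thus "prime_step_avg N (\<lambda>n. ln (real n) - mertens_sum (Suc N) + K) n \<le> ln (real n) - mertens_sum N + K"
      using prime_step_avg_ln[of n N K] survivors_pos[OF Suc.hyps] by simp
  next
    show "ln (real N) - mertens_sum N + K \<ge> 0"
      using mertens[of N] Suc.hyps q_ge_1 by (simp add: abs_le_iff)
  qed
  thus ?case using Suc.IH by simp
qed

lemma excess_bound_nonneg: "excess_bound \<ge> 0"
  using ln_m0_ge K_nonneg by (simp add: excess_bound_def)

text \<open>Beyond \<open>N^(3/2)\<close> the difference \<open>ln n - ln N\<close> is at least a
  third of \<open>ln n\<close>, whence the factor 3. The other survivors enter with nonnegative
  terms because \<open>n \<ge> N\<close>.\<close>

lemma sum_high_le:
  assumes "N \<ge> q"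
  shows "(\<Sum>n\<in>{n\<in>survivors N. N ^ 3 \<le> n ^ 2}. ln (real n) / real n) \<le> 3 * excess_bound * euler_prod N"
proof -
  have N: "N \<ge> 1" using assms q_ge_1 by simp
  have E: "mertens_sum N \<le> ln (real N) + K" using mertens[OF N] by (simp add: abs_le_iff)
  let ?f = "\<lambda>n. 3 * (ln (real n) - mertens_sum N + K)"
  have "(\<Sum>n\<in>{n\<in>survivors N. N ^ 3 \<le> n ^ 2}. ln (real n) / real n)
      \<le> (\<Sum>n\<in>{n\<in>survivors N. N ^ 3 \<le> n ^ 2}. ?f n / real n)"
  proof (intro sum_mono divide_right_mono)
    fix n assume n: "n \<in> {n\<in>survivors N. N ^ 3 \<le> n ^ 2}"
    hence "real N ^ 3 \<le> real n ^ 2" by (simp flip: of_nat_power)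
    moreover have "n > 0" using n survivors_pos[OF assms] by auto
    ultimately have "ln (real N ^ 3) \<le> ln (real n ^ 2)" using N by (subst ln_le_cancel_iff) auto
    hence "3 * ln (real N) \<le> 2 * ln (real n)" using N \<open>n > 0\<close> by (simp add: ln_realpow)
    thus "ln (real n) \<le> ?f n" using E by simp
  qed simp
  also have "\<dots> \<le> (\<Sum>n\<in>survivors N. ?f n / real n)"
  proof (intro sum_mono2)
    fix n assume "n \<in> survivors N - {n\<in>survivors N. N ^ 3 \<le> n ^ 2}"
    hence "N \<le> n" using survivors_props(1)[OF assms] by auto
    hence "ln (real N) \<le> ln (real n)" using N by simp
    thus "0 \<le> ?f n / real n" using E by (intro divide_nonneg_nonneg) auto
  qed auto
  also have "\<dots> = 3 * wmean (\<lambda>n. ln (real n) - mertens_sum N + K) N * euler_prod N"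
    using wmean_scale[of 3 "\<lambda>n. ln (real n) - mertens_sum N + K" N] euler_prod_pos[of N]
    by (simp add: wmean_def)
  also have "\<dots> \<le> 3 * excess_bound * euler_prod N"
    using wmean_ln_upper[OF assms] euler_prod_pos[of N] by (intro mult_right_mono) auto
  finally show ?thesis .
qed

text \<open>The first moment controls only the elements above \<open>N\<close> to the power \<open>3/2\<close>. Multiplying a smaller
  element by a mid prime lands among those, so the small elements are no more numerous.\<close>

lemma wmean_one_le:
  obtains N1 where "N1 \<ge> q" "N1 \<ge> 3" "\<And>N. N \<ge> N1 \<Longrightarrow> wmean (\<lambda>_. 1) N * ln (real N) \<le> 99 * excess_bound"
proof -
  obtain N0 where N0: "\<And>N B. N \<ge> N0 \<Longrightarrow> finite B \<Longrightarrow> (\<And>n. n \<in> B \<Longrightarrow> 0 < n \<and> n \<le> N ^ 2) \<Longrightarrow>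
    (\<Sum>n\<in>B. 1 / real n) \<le>
      16 * (\<Sum>k\<in>mid_extension N B. real (card {p\<in>mid_primes N. p dvd k}) * (1 / real k))"
    using mid_extension_reciprocal_sum[of 2] by blast
  \<comment> \<open>\<open>N \<ge> q^2\<close> puts all mid primes above \<open>q\<close>, as
    \<open>survivors_mult_prime\<close> requires.\<close>
  define N1 where "N1 = N0 + q ^ 2 + q + 3"
  have "wmean (\<lambda>_. 1) N * ln (real N) \<le> 99 * excess_bound" if "N \<ge> N1" for N
  proof -
    have N: "N \<ge> N0" "N \<ge> q ^ 2" "N \<ge> q" "N \<ge> 3" using that by (auto simp: N1_def)
    have lnN: "ln (real N) > 0" using N by simp
    define hi where "hi = {n\<in>survivors N. N ^ 3 \<le> n ^ 2}"
    define lo where "lo = survivors N - hi"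
    define H where "H = (\<Sum>n\<in>hi. ln (real n) / real n)"
    have H: "H \<le> 3 * excess_bound * euler_prod N" using sum_high_le[OF N(3)] by (simp add: H_def hi_def)
    have hipos: "n > 0 \<and> N \<le> n" if "n \<in> hi" for n
      using that survivors_pos[OF N(3)] survivors_props(1)[OF N(3)] by (auto simp: hi_def)
    have ext: "mid_extension N lo \<subseteq> hi"
    proof
      fix k assume "k \<in> mid_extension N lo"
      then obtain n p where k: "k = p * n" "n \<in> survivors N" "p \<in> mid_primes N" "\<not> p dvd n"
        by (auto simp: mid_extension_def lo_def)
      have p: "prime p" "p \<le> N" "N ^ 3 < p ^ 4" using k by (auto simp: mid_primes_def)
      have qp: "q < p"
      proof (rule ccontr)
        assume "\<not> q < p"
        hence "p ^ 4 \<le> q ^ 4" by (intro power_mono) auto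
        also have "\<dots> \<le> (q ^ 2) ^ 3" unfolding power_mult[symmetric]
          using q_ge_1 by (intro power_increasing) auto
        also have "\<dots> \<le> N ^ 3" using N by (intro power_mono) auto
        finally show False using p by simp
      qed
      have kV: "k \<in> survivors N" unfolding k(1) using k p qp N by (intro survivors_mult_prime) auto
      have Nn: "N \<le> n" using survivors_props(1)[OF N(3) k(2)] .
      \<comment> \<open>\<open>p > N^(3/4)\<close> and \<open>n \<ge> N\<close> give
        \<open>p * n > N^(7/4)\<close>, which is beyond the threshold
        \<open>N^(3/2)\<close>.\<close>
      have "(N ^ 3) ^ 2 \<le> N ^ 3 * N ^ 4"
        unfolding power_mult[symmetric] power_add[symmetric] using N by (intro power_increasing) auto
      also have "\<dots> \<le> p ^ 4 * n ^ 4" using p Nn by (intro mult_mono power_mono) auto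
      also have "\<dots> = (k ^ 2) ^ 2" by (simp add: k(1) power_mult_distrib flip: power_mult)
      finally have "N ^ 3 \<le> k ^ 2" by (rule power2_le_imp_le) simp
      thus "k \<in> hi" using kV by (simp add: hi_def)
    qed
    have "(\<Sum>n\<in>lo. 1 / real n) \<le>
      16 * (\<Sum>k\<in>mid_extension N lo. real (card {p\<in>mid_primes N. p dvd k}) * (1 / real k))"
    proof (rule N0[OF N(1)])
      fix n assume "n \<in> lo"
      hence n: "n \<in> survivors N" "n ^ 2 < N ^ 3" by (auto simp: lo_def hi_def)
      have "N ^ 3 \<le> (N ^ 2) ^ 2" unfolding power_mult[symmetric] using N by (intro power_increasing) auto
      hence "n ^ 2 \<le> (N ^ 2) ^ 2" using n by linarith
      hence "n \<le> N ^ 2" by (rule power2_le_imp_le) simp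
      thus "0 < n \<and> n \<le> N ^ 2" using survivors_pos[OF N(3) n(1)] by simp
    qed (simp add: lo_def)
    also have "\<dots> \<le> 16 * (\<Sum>k\<in>hi. real (card {p\<in>mid_primes N. p dvd k}) * (1 / real k))"
      using ext by (intro mult_left_mono sum_mono2) (auto simp: hi_def)
    \<comment> \<open>Elements of \<open>hi\<close> need not stay below a fixed power of
      \<open>N\<close>, so their multiplicity is bounded only by \<open>2 ln k / ln N\<close>; the
      weight \<open>ln k\<close> in \<open>H\<close> absorbs it.\<close>
    also have "\<dots> \<le> 16 * (\<Sum>k\<in>hi. 2 / ln (real N) * (ln (real k) / real k))"
    proof (intro mult_left_mono sum_mono)
      fix k assume "k \<in> hi"
      have "real (card {p\<in>mid_primes N. p dvd k}) * ln (real N) \<le> 2 * ln (real k)"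
        using hipos[OF \<open>k \<in> hi\<close>] N by (intro card_mid_primes_dvd) auto
      hence "real (card {p\<in>mid_primes N. p dvd k}) \<le> 2 * ln (real k) / ln (real N)"
        using lnN by (simp add: field_simps)
      hence "real (card {p\<in>mid_primes N. p dvd k}) * (1 / real k) \<le> (2 * ln (real k) / ln (real N)) * (1 / real k)"
        by (rule mult_right_mono) simp
      thus "real (card {p\<in>mid_primes N. p dvd k}) * (1 / real k) \<le> 2 / ln (real N) * (ln (real k) / real k)"
        by simp
    qed simp
    also have "\<dots> = 32 / ln (real N) * H" by (simp only: H_def sum_distrib_left[symmetric])
    finally have lo_le: "(\<Sum>n\<in>lo. 1 / real n) \<le> 32 / ln (real N) * H" .
    have "(\<Sum>n\<in>hi. 1 / real n) \<le> (\<Sum>n\<in>hi. 1 / ln (real N) * (ln (real n) / real n))"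
    proof (intro sum_mono)
      fix n assume "n \<in> hi"
      hence "ln (real N) \<le> ln (real n)" using hipos N by simp
      hence "1 * (1 / real n) \<le> (ln (real n) / ln (real N)) * (1 / real n)"
        using lnN by (intro mult_right_mono) auto
      thus "1 / real n \<le> 1 / ln (real N) * (ln (real n) / real n)" by simp
    qed
    also have "\<dots> = 1 / ln (real N) * H" by (simp only: H_def sum_distrib_left[symmetric])
    finally have hi_le: "(\<Sum>n\<in>hi. 1 / real n) \<le> 1 / ln (real N) * H" .
    have "survivors N = lo \<union> hi" "lo \<inter> hi = {}" "finite lo" "finite hi" by (auto simp: lo_def hi_def)
    hence "(\<Sum>n\<in>survivors N. 1 / real n) = (\<Sum>n\<in>lo. 1 / real n) + (\<Sum>n\<in>hi. 1 / real n)"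
      by (simp add: sum.union_disjoint)
    also have "\<dots> \<le> 32 / ln (real N) * H + 1 / ln (real N) * H" using lo_le hi_le by linarith
    also have "\<dots> = 33 * H / ln (real N)" by (simp add: add_divide_distrib[symmetric])
    also have "\<dots> \<le> 33 * (3 * excess_bound * euler_prod N) / ln (real N)"
      using H lnN by (intro divide_right_mono mult_left_mono) auto
    finally have "(\<Sum>n\<in>survivors N. 1 / real n) \<le> 99 * excess_bound * euler_prod N / ln (real N)" by simp
    thus ?thesis using euler_prod_pos[of N] lnN by (simp add: wmean_def field_simps)
  qed
  moreover have "N1 \<ge> q" "N1 \<ge> 3" by (simp_all add: N1_def)
  ultimately show ?thesis using that by blast
qed

text \<open>The drift is written with the increment of \<open>mertens_sum\<close> so that the drifts
  telescope over \<open>N\<close>.\<close>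

lemma prime_step_avg_ln_square:
  assumes "n > 0"
  shows "prime_step_avg N (\<lambda>n. ln (real n) ^ 2) n
    = ln (real n) ^ 2 + (mertens_sum (Suc N) - mertens_sum N) * (2 * ln (real n) + ln (real (Suc N)))"
proof (cases "prime (Suc N)")
  case True
  define x where "x = real (Suc N)"
  have x: "x + 1 \<noteq> 0" by (simp add: x_def)
  have ms: "mertens_sum (Suc N) - mertens_sum N = ln x / (x + 1)" using True by (simp add: mertens_sum_Suc x_def)
  have l: "ln (real (Suc N * n)) = ln x + ln (real n)"
    unfolding of_nat_mult x_def using assms by (intro ln_mult_pos) auto
  have "prime_step_avg N (\<lambda>n. ln (real n) ^ 2) n = (x * ln (real n) ^ 2 + (ln x + ln (real n)) ^ 2) / (x + 1)"
    unfolding prime_step_avg_def l using True by (simp add: x_def)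
  also have "\<dots> = ((x + 1) * ln (real n) ^ 2 + ln x * (2 * ln (real n) + ln x)) / (x + 1)"
    by (simp add: algebra_simps power2_eq_square)
  also have "\<dots> = ln (real n) ^ 2 + ln x / (x + 1) * (2 * ln (real n) + ln x)"
    using x by (simp add: add_divide_distrib)
  finally show ?thesis unfolding ms x_def .
next
  case False
  thus ?thesis by (simp add: prime_step_avg_def mertens_sum_Suc)
qed

text \<open>In the drift, the mean of \<open>ln n\<close> is bounded and the mean of 1 is of order
  at most \<open>1 / ln N\<close>, which cancels the factor \<open>ln (Suc N)\<close>. Each step
  thus adds at most \<open>C3\<close> times the increment of \<open>mertens_sum\<close>, and these
  increments sum to at most \<open>ln N + K\<close>.\<close>

lemma wmean_ln_square_le:
  obtains N1 C where "N1 \<ge> q" "N1 \<ge> 3" "C \<ge> 0"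
    "\<And>N. N \<ge> N1 \<Longrightarrow> wmean (\<lambda>n. ln (real n) ^ 2) N \<le> C * ln (real N)"
proof -
  obtain N1 where N1: "N1 \<ge> q" "N1 \<ge> 3" "\<And>N. N \<ge> N1 \<Longrightarrow> wmean (\<lambda>_. 1) N * ln (real N) \<le> 99 * excess_bound"
    using wmean_one_le by blast
  have ln1: "ln (real N) \<ge> 1" if "N \<ge> N1" for N
  proof -
    have "exp 1 \<le> (3::real)" using exp_le by simp
    hence "exp 1 \<le> real N" using that N1(2) by linarith
    thus ?thesis using that N1(2) by (subst ln_ge_iff) auto
  qed
  define C2 where "C2 = excess_bound + 99 * excess_bound * (1 + K)"
  have M: "wmean (\<lambda>n. ln (real n)) N \<le> C2" if N: "N \<ge> N1" for N
  proof -
    have w: "wmean (\<lambda>_. 1) N \<ge> 0" by (rule wmean_nonneg) simp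
    have "wmean (\<lambda>n. ln (real n)) N = wmean (\<lambda>n. (ln (real n) - mertens_sum N + K) + (mertens_sum N - K) * 1) N"
      by simp
    also have "\<dots> = wmean (\<lambda>n. ln (real n) - mertens_sum N + K) N + (mertens_sum N - K) * wmean (\<lambda>_. 1) N"
      by (simp only: wmean_add wmean_scale)
    also have "\<dots> \<le> excess_bound + (mertens_sum N - K) * wmean (\<lambda>_. 1) N"
      using wmean_ln_upper[of N] N N1 by simp
    also have "\<dots> \<le> excess_bound + ln (real N) * (1 + K) * wmean (\<lambda>_. 1) N"
    proof -
      have "mertens_sum N - K \<le> ln (real N)" using mertens[of N] N N1 by (simp add: abs_le_iff)
      also have "\<dots> \<le> ln (real N) * (1 + K)" using ln1[OF N] K_nonneg by (simp add: algebra_simps)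
      finally show ?thesis using w by (intro add_left_mono mult_right_mono) auto
    qed
    also have "\<dots> = excess_bound + (1 + K) * (wmean (\<lambda>_. 1) N * ln (real N))" by simp
    also have "\<dots> \<le> excess_bound + (1 + K) * (99 * excess_bound)"
      using N1(3)[OF N] K_nonneg by (intro add_left_mono mult_left_mono) auto
    finally show ?thesis by (simp add: C2_def mult_ac)
  qed
  define C3 where "C3 = 2 * C2 + 198 * excess_bound"
  have C2: "C2 \<ge> 0" using excess_bound_nonneg K_nonneg by (simp add: C2_def)
  have C3: "C3 \<ge> 0" using excess_bound_nonneg C2 by (simp add: C3_def)
  define s where "s = wmean (\<lambda>n. ln (real n) ^ 2)"
  have s0: "s N \<ge> 0" for N unfolding s_def by (rule wmean_nonneg) simp
  have step: "s N \<le> s N1 + C3 * (mertens_sum N - mertens_sum N1)" if "N \<ge> N1" for N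
    using that
  proof (induction N rule: nat_induct_at_least)
    case base
    show ?case by simp
  next
    case (Suc N)
    have Nq: "N \<ge> q" and N3: "N \<ge> 3" using Suc.hyps N1 by auto
    define d where "d = mertens_sum (Suc N) - mertens_sum N"
    have d: "d \<ge> 0" using mertens_sum_mono[of N "Suc N"] by (simp add: d_def)
    have lnS: "ln (real (Suc N)) \<le> 2 * ln (real N)"
    proof -
      have "3 * N \<le> N * N" using N3 by simp
      hence "Suc N \<le> N ^ 2" unfolding power2_eq_square using N3 by linarith
      hence "real (Suc N) \<le> real N ^ 2" by (simp flip: of_nat_power)
      hence "ln (real (Suc N)) \<le> ln (real N ^ 2)" using N3 by (subst ln_le_cancel_iff) auto
      thus ?thesis using N3 by (simp add: ln_realpow)
    qed
    have "s (Suc N) \<le> wmean (\<lambda>n. ln (real n) ^ 2 + d * (2 * ln (real n) + ln (real (Suc N)))) N"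
      unfolding s_def
    proof (rule wmean_Suc_le[OF Nq])
      fix n assume "n \<in> survivors N"
      thus "prime_step_avg N (\<lambda>n. ln (real n) ^ 2) n \<le> ln (real n) ^ 2 + d * (2 * ln (real n) + ln (real (Suc N)))"
        using prime_step_avg_ln_square[of n N] survivors_pos[OF Nq] by (simp add: d_def)
    next
      show "0 \<le> ln (real N) ^ 2 + d * (2 * ln (real N) + ln (real (Suc N)))"
        using d N3 by (intro add_nonneg_nonneg mult_nonneg_nonneg) auto
    qed
    also have "\<dots> = wmean (\<lambda>n. ln (real n) ^ 2 + (d * 2 * ln (real n) + d * ln (real (Suc N)) * 1)) N"
      by (simp only: distrib_left mult.assoc mult_1_right)
    also have "\<dots> = s N + (d * 2 * wmean (\<lambda>n. ln (real n)) N + d * ln (real (Suc N)) * wmean (\<lambda>_. 1) N)"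
      by (simp only: wmean_add wmean_scale s_def)
    also have "\<dots> = s N + d * (2 * wmean (\<lambda>n. ln (real n)) N + ln (real (Suc N)) * wmean (\<lambda>_. 1) N)"
      by (simp add: algebra_simps)
    also have "\<dots> \<le> s N + d * C3"
    proof -
      have "ln (real (Suc N)) * wmean (\<lambda>_. 1) N \<le> 2 * ln (real N) * wmean (\<lambda>_. 1) N"
        using lnS by (intro mult_right_mono wmean_nonneg) auto
      also have "\<dots> \<le> 198 * excess_bound" using N1(3)[OF Suc.hyps] by (simp add: mult_ac)
      finally have "2 * wmean (\<lambda>n. ln (real n)) N + ln (real (Suc N)) * wmean (\<lambda>_. 1) N \<le> C3"
        using M[OF Suc.hyps] by (simp add: C3_def)
      thus ?thesis using d by (intro add_left_mono mult_left_mono)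
    qed
    also have "\<dots> \<le> s N1 + C3 * (mertens_sum N - mertens_sum N1) + d * C3" using Suc.IH by simp
    also have "\<dots> = s N1 + C3 * (mertens_sum (Suc N) - mertens_sum N1)" by (simp add: d_def algebra_simps)
    finally show ?case .
  qed
  define C where "C = s N1 + C3 * (1 + K)"
  have "s N \<le> C * ln (real N)" if N: "N \<ge> N1" for N
  proof -
    have "mertens_sum N - mertens_sum N1 \<le> ln (real N) + K"
      using mertens[of N] N N1 mertens_sum_nonneg[of N1] by (simp add: abs_le_iff)
    also have "\<dots> \<le> (1 + K) * ln (real N)"
      using ln1[OF N] K_nonneg mult_left_mono[of 1 "ln (real N)" K] by (simp add: algebra_simps)
    finally have "C3 * (mertens_sum N - mertens_sum N1) \<le> C3 * ((1 + K) * ln (real N))"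
      using C3 by (rule mult_left_mono)
    moreover have "s N1 \<le> s N1 * ln (real N)" using s0[of N1] ln1[OF N] mult_left_mono[of 1 "ln (real N)" "s N1"] by simp
    ultimately show ?thesis using step[OF N] by (simp add: C_def algebra_simps)
  qed
  moreover have "C \<ge> 0" using s0 C3 K_nonneg by (simp add: C_def)
  ultimately show ?thesis using that N1 unfolding s_def by blast
qed

text \<open>On the part below \<open>N^J\<close>, replacing \<open>ln n\<close> by
  \<open>J ln N\<close> loses a factor \<open>ln N\<close>; the lower bound \<open>a * ln N\<close>
  for \<open>euler_prod N\<close> restores it.\<close>

lemma sum_survivors_bounded_ge:
  obtains c J N1 where "c > 0" "N1 \<ge> q" "J \<ge> 1"
    "\<And>N. N \<ge> N1 \<Longrightarrow> c \<le> (\<Sum>n\<in>{n\<in>survivors N. n \<le> N ^ J}. 1 / real n)"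
proof -
  obtain N1 C where N1: "N1 \<ge> q" "N1 \<ge> 3" "C \<ge> 0"
    "\<And>N. N \<ge> N1 \<Longrightarrow> wmean (\<lambda>n. ln (real n) ^ 2) N \<le> C * ln (real N)"
    using wmean_ln_square_le by blast
  obtain a where a: "a > 0" "\<And>N. N \<ge> q \<Longrightarrow> a * ln (real N) \<le> euler_prod N" using euler_prod_ge by blast
  have m0: "real m0 > 0" using m0_ge q_ge_1 by simp
  \<comment> \<open>Above \<open>N^J\<close>, \<open>ln n\<close> is at most
    \<open>(ln n)^2 / (J ln N)\<close>, so that part contributes at most
    \<open>euler_prod N * (C / J)\<close>; this \<open>J\<close> makes it at most half of the lower
    bound \<open>euler_prod N / m0\<close>.\<close>
  define J where "J = nat \<lceil>2 * real m0 * C\<rceil> + 1"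
  have J: "J \<ge> 1" "real J \<ge> 2 * real m0 * C" unfolding J_def by (simp, linarith)
  define c where "c = a / (2 * real m0 * real J)"
  have c: "c > 0" using a m0 J by (simp add: c_def)
  have "c \<le> (\<Sum>n\<in>{n\<in>survivors N. n \<le> N ^ J}. 1 / real n)" if "N \<ge> N1" for N
  proof -
    have N: "N \<ge> q" "N \<ge> 3" using that N1 by auto
    have lnN: "ln (real N) > 0" using N by simp
    define lo where "lo = {n\<in>survivors N. n \<le> N ^ J}"
    define hi where "hi = {n\<in>survivors N. \<not> n \<le> N ^ J}"
    have "1 / real m0 \<le> wmean (\<lambda>n. ln (real n) - mertens_sum N - K) N" by (rule wmean_ln_lower) fact
    also have "\<dots> \<le> wmean (\<lambda>n. ln (real n)) N"
      using mertens_sum_nonneg[of N] K_nonneg by (intro wmean_mono) simp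
    finally have "euler_prod N / real m0 \<le> (\<Sum>n\<in>survivors N. ln (real n) / real n)"
      using euler_prod_pos[of N] m0 by (simp add: wmean_def field_simps)
    also have "\<dots> = (\<Sum>n\<in>lo. ln (real n) / real n) + (\<Sum>n\<in>hi. ln (real n) / real n)"
      by (subst sum.union_disjoint[symmetric]) (auto simp: lo_def hi_def intro!: sum.cong)
    also have "(\<Sum>n\<in>hi. ln (real n) / real n) \<le> (\<Sum>n\<in>hi. ln (real n) ^ 2 / real n / (real J * ln (real N)))"
    proof (intro sum_mono)
      fix n assume "n \<in> hi"
      hence n: "n > 0" "N ^ J < n" using survivors_pos[OF N(1)] by (auto simp: hi_def)
      hence "real N ^ J \<le> real n" by (simp flip: of_nat_power)
      hence "ln (real N ^ J) \<le> ln (real n)" using N n by (subst ln_le_cancel_iff) auto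
      hence l: "real J * ln (real N) \<le> ln (real n)" using N by (simp add: ln_realpow)
      moreover have Jp: "real J * ln (real N) > 0" using J lnN by simp
      ultimately have "ln (real n) * (real J * ln (real N)) \<le> ln (real n) * ln (real n)"
        by (intro mult_left_mono) auto
      hence "ln (real n) \<le> ln (real n) ^ 2 / (real J * ln (real N))"
        using Jp by (subst pos_le_divide_eq) (auto simp: power2_eq_square)
      hence "ln (real n) / real n \<le> ln (real n) ^ 2 / (real J * ln (real N)) / real n"
        by (intro divide_right_mono) auto
      thus "ln (real n) / real n \<le> ln (real n) ^ 2 / real n / (real J * ln (real N))"
        by (simp add: mult_ac)
    qed
    also have "\<dots> \<le> (\<Sum>n\<in>survivors N. ln (real n) ^ 2 / real n / (real J * ln (real N)))"
      using lnN by (intro sum_mono2) (auto simp: hi_def)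
    also have "\<dots> = wmean (\<lambda>n. ln (real n) ^ 2) N * euler_prod N / (real J * ln (real N))"
      using euler_prod_pos[of N] by (simp only: sum_divide_distrib[symmetric] wmean_def) simp
    also have "\<dots> \<le> C * ln (real N) * euler_prod N / (real J * ln (real N))"
      using N1(4)[OF that] euler_prod_pos[of N] lnN J
      by (intro divide_right_mono mult_right_mono) (auto intro!: mult_nonneg_nonneg)
    also have "\<dots> = euler_prod N * (C / real J)" using lnN by simp
    also have "\<dots> \<le> euler_prod N * (1 / (2 * real m0))"
    proof -
      have "C / real J \<le> 1 / (2 * real m0)" using J m0 by (simp add: field_simps)
      thus ?thesis using euler_prod_pos[of N] by (intro mult_left_mono) auto
    qed
    finally have "euler_prod N / (2 * real m0) \<le> (\<Sum>n\<in>lo. ln (real n) / real n)" by simp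
    also have "\<dots> \<le> (\<Sum>n\<in>lo. real J * ln (real N) * (1 / real n))"
    proof (intro sum_mono)
      fix n assume "n \<in> lo"
      hence n: "n > 0" "n \<le> N ^ J" using survivors_pos[OF N(1)] by (auto simp: lo_def)
      hence "real n \<le> real N ^ J" by (simp flip: of_nat_power)
      hence "ln (real n) \<le> ln (real N ^ J)" using N n by (subst ln_le_cancel_iff) auto
      hence "ln (real n) \<le> real J * ln (real N)" using N by (simp add: ln_realpow)
      hence "ln (real n) * (1 / real n) \<le> real J * ln (real N) * (1 / real n)"
        by (intro mult_right_mono) auto
      thus "ln (real n) / real n \<le> real J * ln (real N) * (1 / real n)" by simp
    qed
    also have "\<dots> = real J * ln (real N) * (\<Sum>n\<in>lo. 1 / real n)" by (simp only: sum_distrib_left)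
    finally have "euler_prod N / (2 * real m0) \<le> real J * ln (real N) * (\<Sum>n\<in>lo. 1 / real n)" .
    moreover have "a * ln (real N) / (2 * real m0) \<le> euler_prod N / (2 * real m0)"
      using a(2)[OF N(1)] m0 by (intro divide_right_mono) auto
    ultimately have "ln (real N) * (a / (2 * real m0)) \<le> ln (real N) * (real J * (\<Sum>n\<in>lo. 1 / real n))"
      by (simp add: mult_ac)
    hence "a / (2 * real m0) \<le> real J * (\<Sum>n\<in>lo. 1 / real n)" using lnN by (simp only: mult_le_cancel_left_pos)
    hence "a / (2 * real m0) / real J \<le> (\<Sum>n\<in>lo. 1 / real n)"
      using J by (subst pos_divide_le_eq) (auto simp: mult.commute)
    thus ?thesis unfolding c_def lo_def by simp
  qed
  thus ?thesis using that c J N1 by blast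
qed

end

subsection \<open>Counting\<close>

lemma prime_dvd_prod_primes_upto:
  assumes "prime p" "p dvd \<Prod>(primes_upto q)"
  shows "p \<le> q"
proof -
  have "\<exists>r\<in>primes_upto q. p dvd r" using assms by (subst (asm) prime_dvd_prod_iff) auto
  then obtain r where "r \<in> primes_upto q" "p dvd r" by blast
  thus ?thesis using assms primes_dvd_imp_eq by (auto simp: primes_upto_def)
qed

lemma prod_primes_upto_practical: "\<Prod>(primes_upto q) \<in> sqfree_practical"
proof (induction q)
  case 0
  have "primes_upto 0 = {}" by (auto simp: primes_upto_def)
  thus ?case using one_in_sqfree_practical by simp
next
  case (Suc q)
  show ?case
  proof (cases "prime (Suc q)")
    case True
    let ?m = "\<Prod>(primes_upto q)"
    \<comment> \<open>Euclid's argument bounds the next prime, so Bertrand's postulate is not needed.\<close>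
    have "?m + 1 \<noteq> 1" using sqfree_practical_pos[OF Suc.IH] by linarith
    then obtain r where r: "prime r" "r dvd ?m + 1" using prime_factor_nat by blast
    have "r > q"
    proof (rule ccontr)
      assume "\<not> r > q"
      hence "r \<in> primes_upto q" using r by (auto simp: primes_upto_def)
      hence "r dvd ?m" using dvd_prodI[of "primes_upto q" r "\<lambda>p. p"] by simp
      hence "r dvd 1" using r by (metis dvd_add_right_iff)
      thus False using r by (simp add: prime_nat_iff)
    qed
    moreover have "r \<le> ?m + 1" using r by (intro dvd_imp_le) auto
    ultimately have "Suc q \<le> ?m + 2" by linarith
    moreover have "\<not> Suc q dvd ?m" using prime_dvd_prod_primes_upto[OF True, of q] by auto
    ultimately have "Suc q * ?m \<in> sqfree_practical"
      using True Suc.IH by (intro sqfree_practical_mult_prime) auto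
    moreover have "Suc q \<notin> primes_upto q" by (simp add: primes_upto_def)
    ultimately show ?thesis using True by (simp add: primes_upto_Suc del: mult_Suc)
  qed (use Suc in \<open>simp add: primes_upto_Suc\<close>)
qed

text \<open>Each prime contributes at least \<open>ln 2 / 2\<close>, so by the infinitude of primes
  a large primorial satisfies \<open>ln_m0_ge\<close> for any given \<open>K\<close>.\<close>

lemma ln_prod_primes_upto_minus_mertens_sum:
  "ln (real (\<Prod>(primes_upto q))) - mertens_sum q \<ge> real (card (primes_upto q)) * (ln 2 / 2)"
proof -
  have "ln (real (\<Prod>(primes_upto q))) = (\<Sum>p\<in>primes_upto q. ln (real p))"
    unfolding of_nat_prod by (rule ln_prod) (auto simp: primes_upto_def prime_gt_0_nat)
  hence "ln (real (\<Prod>(primes_upto q))) - mertens_sum q = (\<Sum>p\<in>primes_upto q. ln (real p) - ln (real p) / (real p + 1))"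
    by (simp add: mertens_sum_def sum_subtractf)
  also have "\<dots> \<ge> (\<Sum>p\<in>primes_upto q. ln 2 / 2)"
  proof (intro sum_mono)
    fix p assume "p \<in> primes_upto q"
    hence p: "p \<ge> 2" by (auto simp: primes_upto_def prime_ge_2_nat)
    have "ln (real p) / (real p + 1) \<le> ln (real p) / 2" using p by (intro divide_left_mono) auto
    moreover have "ln 2 \<le> ln (real p)" using p by simp
    ultimately show "ln 2 / 2 \<le> ln (real p) - ln (real p) / (real p + 1)" by linarith
  qed
  finally show ?thesis by simp
qed

lemma practical_reciprocal_sum:
  obtains c J N1 where "c > 0" "J \<ge> 1"
    "\<And>N. N \<ge> N1 \<Longrightarrow> \<exists>B. finite B \<and> B \<subseteq> sqfree_practical \<and> (\<forall>n\<in>B. N \<le> n \<and> n \<le> N ^ J) \<and>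
       c \<le> (\<Sum>n\<in>B. 1 / real n)"
proof -
  obtain K where K: "K \<ge> 0" "\<And>N. N \<ge> 1 \<Longrightarrow> \<bar>mertens_sum N - ln (real N)\<bar> \<le> K"
    using mertens_sum_bound by blast
  \<comment> \<open>The number of primes after which these contributions reach
    \<open>K + 1\<close>.\<close>
  define k where "k = nat \<lceil>(K + 1) / (ln 2 / 2)\<rceil> + 1"
  have "(K + 1) / (ln 2 / 2) \<le> real k" unfolding k_def by linarith
  hence k: "K + 1 \<le> real k * (ln 2 / 2)" by (subst (asm) pos_divide_le_eq) auto
  obtain A where A: "A \<subseteq> {p::nat. prime p}" "finite A" "card A = k"
    using infinite_arbitrarily_large[OF primes_infinite] by blast
  define q where "q = Max A"
  have "A \<noteq> {}" using A by (auto simp: k_def)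
  hence qA: "q \<in> A" using A by (simp add: q_def)
  hence q: "prime q" using A by auto
  have "A \<subseteq> primes_upto q" using A by (auto simp: primes_upto_def q_def)
  hence card: "k \<le> card (primes_upto q)" using A by (metis card_mono finite_primes_upto)
  define m0 where "m0 = \<Prod>(primes_upto q)"
  have m0: "m0 \<in> sqfree_practical" unfolding m0_def by (rule prod_primes_upto_practical)
  interpret dense_process q m0 K
  proof
    show "q \<ge> 1" using q prime_ge_1_nat by simp
    show "K \<ge> 0" by fact
    show "\<And>N. N \<ge> 1 \<Longrightarrow> \<bar>mertens_sum N - ln (real N)\<bar> \<le> K" by fact
    show "m0 \<in> sqfree_practical" by fact
    have "q dvd m0" unfolding m0_def using q dvd_prodI[of "primes_upto q" q "\<lambda>p. p"]
      by (simp add: primes_upto_def)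
    thus "q \<le> m0" using sqfree_practical_pos[OF m0] by (intro dvd_imp_le)
    show "p \<le> q" if "prime p" "p dvd m0" for p
      using that prime_dvd_prod_primes_upto unfolding m0_def by blast
    have "real k * (ln 2 / 2) \<le> real (card (primes_upto q)) * (ln 2 / 2)"
      using card by (intro mult_right_mono) auto
    also have "\<dots> \<le> ln (real m0) - mertens_sum q"
      unfolding m0_def by (rule ln_prod_primes_upto_minus_mertens_sum)
    finally show "ln (real m0) \<ge> mertens_sum q + K + 1" using k by linarith
  qed
  obtain c J N1 where c: "c > 0" "N1 \<ge> q" "J \<ge> 1"
    "\<And>N. N \<ge> N1 \<Longrightarrow> c \<le> (\<Sum>n\<in>{n\<in>survivors N. n \<le> N ^ J}. 1 / real n)"
    by (rule sum_survivors_bounded_ge) blast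
  have "\<exists>B. finite B \<and> B \<subseteq> sqfree_practical \<and> (\<forall>n\<in>B. N \<le> n \<and> n \<le> N ^ J) \<and> c \<le> (\<Sum>n\<in>B. 1 / real n)"
    if "N \<ge> N1" for N
  proof (intro exI conjI)
    show "c \<le> (\<Sum>n\<in>{n\<in>survivors N. n \<le> N ^ J}. 1 / real n)" using c that by blast
  qed (use survivors_props[of N] that c in auto)
  thus ?thesis using that c by blast
qed

text \<open>Each round multiplies by one mid prime: the lower exponent of \<open>N\<close> grows by
  3/4, the upper one by 1, and the sum of reciprocals loses only a constant factor. The lower bound
  is stated for \<open>n ^ 4\<close> to keep exponents integral.\<close>

lemma practical_reciprocal_sum_extend:
  assumes J: "J \<ge> 1" and base: "c > 0"
    "\<And>N. N \<ge> N1 \<Longrightarrow> \<exists>B. finite B \<and> B \<subseteq> sqfree_practical \<and> (\<forall>n\<in>B. N \<le> n \<and> n \<le> N ^ J) \<and>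
       c \<le> (\<Sum>n\<in>B. 1 / real n)"
  shows "\<exists>c>0. \<exists>N1. \<forall>N\<ge>N1. \<exists>B. finite B \<and> B \<subseteq> sqfree_practical \<and>
    (\<forall>n\<in>B. N ^ (4 + 3 * j) \<le> n ^ 4 \<and> n \<le> N ^ (J + j)) \<and> c \<le> (\<Sum>n\<in>B. 1 / real n)"
proof (induction j)
  case 0
  have "\<forall>N\<ge>N1. \<exists>B. finite B \<and> B \<subseteq> sqfree_practical \<and>
    (\<forall>n\<in>B. N ^ (4 + 3 * 0) \<le> n ^ 4 \<and> n \<le> N ^ (J + 0)) \<and> c \<le> (\<Sum>n\<in>B. 1 / real n)"
  proof (intro allI impI)
    fix N assume N: "N \<ge> N1"
    obtain B where "finite B" "B \<subseteq> sqfree_practical" "\<forall>n\<in>B. N \<le> n \<and> n \<le> N ^ J" "c \<le> (\<Sum>n\<in>B. 1 / real n)"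
      using base(2)[OF N] by blast
    thus "\<exists>B. finite B \<and> B \<subseteq> sqfree_practical \<and>
      (\<forall>n\<in>B. N ^ (4 + 3 * 0) \<le> n ^ 4 \<and> n \<le> N ^ (J + 0)) \<and> c \<le> (\<Sum>n\<in>B. 1 / real n)"
      by (intro exI[of _ B]) (simp add: power_mono)
  qed
  thus ?case using base(1) by blast
next
  case (Suc j)
  then obtain c N1 where c: "c > 0" "\<And>N. N \<ge> N1 \<Longrightarrow> \<exists>B. finite B \<and> B \<subseteq> sqfree_practical \<and>
    (\<forall>n\<in>B. N ^ (4 + 3 * j) \<le> n ^ 4 \<and> n \<le> N ^ (J + j)) \<and> c \<le> (\<Sum>n\<in>B. 1 / real n)" by blast
  obtain N0 where N0: "\<And>N B. N \<ge> N0 \<Longrightarrow> finite B \<Longrightarrow> (\<And>n. n \<in> B \<Longrightarrow> 0 < n \<and> n \<le> N ^ (J + j)) \<Longrightarrow>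
    (\<Sum>n\<in>B. 1 / real n) \<le>
      16 * (\<Sum>k\<in>mid_extension N B. real (card {p\<in>mid_primes N. p dvd k}) * (1 / real k))"
    using mid_extension_reciprocal_sum[of "J + j"] by blast
  \<comment> \<open>16 is the loss in \<open>mid_extension_reciprocal_sum\<close>, and
    \<open>2 * (J + Suc j)\<close> bounds the number of mid primes dividing a product of size at
    most \<open>N^(J + Suc j)\<close>.\<close>
  define C where "C = 32 * real (J + Suc j)"
  have C: "C > 0" using J by (simp add: C_def)
  have "\<exists>B. finite B \<and> B \<subseteq> sqfree_practical \<and>
    (\<forall>n\<in>B. N ^ (4 + 3 * Suc j) \<le> n ^ 4 \<and> n \<le> N ^ (J + Suc j)) \<and> c / C \<le> (\<Sum>n\<in>B. 1 / real n)"
    if "N \<ge> max (max N0 N1) 2" for N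
  proof -
    have N: "N \<ge> N0" "N \<ge> N1" "N \<ge> 2" using that by auto
    obtain B where B: "finite B" "B \<subseteq> sqfree_practical"
      "\<And>n. n \<in> B \<Longrightarrow> N ^ (4 + 3 * j) \<le> n ^ 4 \<and> n \<le> N ^ (J + j)" "c \<le> (\<Sum>n\<in>B. 1 / real n)"
      using c(2)[OF N(2)] by blast
    let ?B = "mid_extension N B"
    have Nn: "N \<le> n" if "n \<in> B" for n
    proof -
      have "N ^ 4 \<le> N ^ (4 + 3 * j)" using N by (intro power_increasing) auto
      hence "N ^ 4 \<le> n ^ 4" using B(3)[OF that] by linarith
      thus ?thesis using power_mono_iff[of N n 4] by simp
    qed
    have "?B = (\<lambda>(n, p). p * n) ` (SIGMA n:B. {p\<in>mid_primes N. \<not> p dvd n})"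
      by (force simp: mid_extension_def image_iff)
    hence fin: "finite ?B" using B(1) by simp
    have props: "k \<in> sqfree_practical \<and> N ^ (4 + 3 * Suc j) \<le> k ^ 4 \<and> k \<le> N ^ (J + Suc j)" if kB: "k \<in> ?B" for k
    proof -
      obtain n p where k: "k = p * n" "n \<in> B" "prime p" "p \<le> N" "N ^ 3 < p ^ 4" "\<not> p dvd n"
        using kB by (auto simp: mid_extension_def mid_primes_def)
      have "k \<in> sqfree_practical"
        unfolding k(1) using k B(2) Nn[OF k(2)] by (intro sqfree_practical_mult_prime) auto
      moreover have "N ^ 3 * N ^ (4 + 3 * j) \<le> p ^ 4 * n ^ 4"
        using k B(3)[OF k(2)] by (intro mult_mono) auto
      hence "N ^ (4 + 3 * Suc j) \<le> k ^ 4" by (simp add: k(1) power_mult_distrib flip: power_add)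
      moreover have "p * n \<le> N * N ^ (J + j)" using k B(3)[OF k(2)] by (intro mult_mono) auto
      hence "k \<le> N ^ (J + Suc j)" by (simp add: k(1))
      ultimately show ?thesis by blast
    qed
    have "c \<le> 16 * (\<Sum>k\<in>?B. real (card {p\<in>mid_primes N. p dvd k}) * (1 / real k))"
    proof (rule order.trans[OF B(4)], rule N0[OF N(1) B(1)])
      fix n assume "n \<in> B"
      thus "0 < n \<and> n \<le> N ^ (J + j)" using B sqfree_practical_pos by blast
    qed
    also have "\<dots> \<le> 16 * (\<Sum>k\<in>?B. 2 * real (J + Suc j) * (1 / real k))"
    proof (intro mult_left_mono sum_mono mult_right_mono)
      fix k assume k: "k \<in> ?B"
      have kp: "k > 0" using props[OF k] sqfree_practical_pos by blast
      have "real k \<le> real N ^ (J + Suc j)" using props[OF k] unfolding of_nat_power[symmetric] of_nat_le_iff by blast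
      hence "ln (real k) \<le> ln (real N ^ (J + Suc j))" using N kp by (subst ln_le_cancel_iff) auto
      also have "\<dots> = real (J + Suc j) * ln (real N)" using N by (subst ln_realpow) auto
      finally have "real (card {p\<in>mid_primes N. p dvd k}) * ln (real N) \<le> 2 * real (J + Suc j) * ln (real N)"
        using card_mid_primes_dvd[of k N] kp N by linarith
      thus "real (card {p\<in>mid_primes N. p dvd k}) \<le> 2 * real (J + Suc j)"
        by (rule mult_right_le_imp_le) (use N in simp)
    qed auto
    also have "\<dots> = C * (\<Sum>k\<in>?B. 1 / real k)" by (simp only: C_def sum_distrib_left[symmetric])
    finally have "c / C \<le> (\<Sum>k\<in>?B. 1 / real k)" using C by (simp add: field_simps)
    thus ?thesis using fin props by (intro exI[of _ ?B]) blast
  qed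
  thus ?case using c(1) C by (intro exI[of _ "c / C"] conjI exI[of _ "max (max N0 N1) 2"]) auto
qed

text \<open>Bounded error in Mertens' theorem forces the terms \<open>ln p / (p + 1)\<close> between
  \<delta>\<open>y\<close> and \<open>y\<close> to sum to at least 1 once \<delta> is small enough,
  and each term is at most \<open>ln y\<close> divided by \<delta>\<open>y\<close>.\<close>

lemma primes_in_interval:
  obtains \<delta> :: real and y0 where "\<delta> > 0" "\<delta> < 1"
    "\<And>y. y \<ge> y0 \<Longrightarrow> \<delta> * y / ln y \<le> real (card {p::nat. prime p \<and> \<delta> * y < real p \<and> real p \<le> y})"
proof -
  obtain K where K: "K \<ge> 0" "\<And>N. N \<ge> 1 \<Longrightarrow> \<bar>mertens_sum N - ln (real N)\<bar> \<le> K"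
    using mertens_sum_bound by blast
  \<comment> \<open>The exponent pays for the error \<open>K\<close> at both ends and leaves 1;
    halving pays for estimating the integer part of \<open>y\<close> from below by
    \<open>y / 2\<close>.\<close>
  define \<delta> :: real where "\<delta> = exp (- (2 * K + 1)) / 2"
  have "exp (- (2 * K + 1)) \<le> 1" using K by (subst exp_le_one_iff) simp
  hence d: "\<delta> > 0" "\<delta> < 1" unfolding \<delta>_def by (simp, linarith)
  have ld: "ln (2 * \<delta>) = - (2 * K + 1)" by (simp add: \<delta>_def)
  define y0 where "y0 = 2 / \<delta>"
  have y02: "y0 \<ge> 2" using d by (simp add: y0_def field_simps)
  have "\<delta> * y / ln y \<le> real (card {p::nat. prime p \<and> \<delta> * y < real p \<and> real p \<le> y})" if y: "y \<ge> y0" for y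
  proof -
    let ?A = "{p::nat. prime p \<and> \<delta> * y < real p \<and> real p \<le> y}"
    have y2: "y \<ge> 2" "\<delta> * y \<ge> 2" using y y02 d by (simp, simp add: y0_def field_simps)
    define N where "N = nat \<lfloor>y\<rfloor>"
    define M where "M = nat \<lfloor>\<delta> * y\<rfloor>"
    have N: "real N \<le> y" "y < real N + 1" "N \<ge> 1" unfolding N_def using y2 by linarith+
    have M: "real M \<le> \<delta> * y" "\<delta> * y < real M + 1" "M \<ge> 1" unfolding M_def using y2 by linarith+
    have "\<delta> * y \<le> 1 * y" using d y2 by (intro mult_right_mono) auto
    hence MN: "M \<le> N" unfolding M_def N_def by (intro nat_mono floor_mono) simp
    have A: "primes_upto N - primes_upto M = ?A"
    proof (intro set_eqI iffI)
      fix p assume "p \<in> primes_upto N - primes_upto M"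
      hence p: "prime p" "p \<le> N" "p \<ge> M + 1" by (auto simp: primes_upto_def)
      have "real p \<ge> real M + 1" using p(3) by linarith
      thus "p \<in> ?A" using p N M by auto
    next
      fix p assume p: "p \<in> ?A"
      hence "p \<le> N" using N by (auto simp: N_def le_nat_floor)
      moreover have "\<not> p \<le> M" using p M by auto
      ultimately show "p \<in> primes_upto N - primes_upto M" using p by (auto simp: primes_upto_def)
    qed
    have "ln (y / 2) \<le> ln (real N)" using N y2 by (subst ln_le_cancel_iff) auto
    moreover have "ln (real M) \<le> ln (\<delta> * y)" using M y2 by (subst ln_le_cancel_iff) auto
    moreover have "ln (y / 2) - ln (\<delta> * y) = - ln (2 * \<delta>)"
      using d y2 by (simp add: ln_div ln_mult)
    ultimately have "1 \<le> mertens_sum N - mertens_sum M"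
      using K(2)[OF N(3)] K(2)[OF M(3)] ld by (simp add: abs_le_iff)
    also have "\<dots> = (\<Sum>p\<in>?A. ln (real p) / (real p + 1))"
      unfolding mertens_sum_def A[symmetric] using MN by (subst sum_diff) (auto simp: primes_upto_def)
    also have "\<dots> \<le> (\<Sum>p\<in>?A. ln y / (\<delta> * y))"
      using y2 by (intro sum_mono frac_le) (auto simp: prime_gt_0_nat)
    also have "\<dots> = real (card ?A) * (ln y / (\<delta> * y))" by simp
    finally have "1 \<le> real (card ?A) * (ln y / (\<delta> * y))" .
    thus ?thesis using y2 by (simp add: field_simps)
  qed
  thus ?thesis using that d by blast
qed

section \<open>Choosing the last prime\<close>

lemma finite_nat_le_real: "finite {n::nat. real n \<le> X \<and> Q n}"
  by (rule finite_subset[of _ "{..nat \<lfloor>X\<rfloor>}"]) (auto simp: le_nat_floor)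

lemma card_large_prime_divisors_le:
  fixes N k L :: nat
  assumes "finite A" "\<And>p. p \<in> A \<Longrightarrow> prime p \<and> p dvd k \<and> sqrt (real N) \<le> real p"
    and "0 < k" "real k \<le> (2 * real N) ^ L" "N \<ge> 2"
  shows "real (card A) \<le> 4 * real L"
proof -
  have lnN: "ln (real N) > 0" using assms by simp
  have "real (card A) * (ln (real N) / 2) \<le> ln (real k)"
  proof (rule card_primes_dvd_le)
    fix p assume p: "p \<in> A"
    have "ln (sqrt (real N)) \<le> ln (real p)"
      using assms(2)[OF p] assms(5) prime_gt_0_nat[of p] by (subst ln_le_cancel_iff) auto
    thus "ln (real N) / 2 \<le> ln (real p)" using assms(5) by (simp add: ln_sqrt)
  qed (use assms in auto)
  also have "\<dots> \<le> ln ((2 * real N) ^ L)" using assms by (subst ln_le_cancel_iff) auto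
  also have "\<dots> = real L * ln (2 * real N)" by (rule ln_realpow)
  also have "ln (2 * real N) \<le> 2 * ln (real N)" using assms by (simp add: ln_mult)
  finally have "real (card A) * ln (real N) \<le> (4 * real L) * ln (real N)"
    by (simp add: mult_left_mono)
  thus ?thesis using lnN by (rule mult_right_le_imp_le)
qed

text \<open>With \<open>N\<close> the integer part of the \<open>L\<close>-th root of
  \<open>X\<close>, every \<open>n\<close> in \<open>B\<close> satisfies
  \<open>N \<le> X / n \<le> n\<close>. So there are many primes \<open>p\<close> just below
  \<open>X / n\<close>, and all of them are admissible for \<open>n\<close>. Summed over
  \<open>B\<close> this gives order \<open>X / ln X\<close> pairs, and each product arises from at
  most \<open>4L\<close> of them.\<close>

lemma practical_count_large:
  obtains l X0 where "l > 0"
    "\<And>X. X \<ge> X0 \<Longrightarrow> l * X / ln X \<le> real (card {n::nat. real n \<le> X \<and> n \<in> sqfree_practical})"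
proof -
  obtain c' J N1' where c': "c' > 0" "J \<ge> 1"
    "\<And>N. N \<ge> N1' \<Longrightarrow> \<exists>B. finite B \<and> B \<subseteq> sqfree_practical \<and> (\<forall>n\<in>B. N \<le> n \<and> n \<le> N ^ J) \<and>
       c' \<le> (\<Sum>n\<in>B. 1 / real n)"
    using practical_reciprocal_sum by blast
  \<comment> \<open>After \<open>2 * J\<close> rounds the elements are at most
    \<open>N^(3J)\<close>; the extra 1 leaves room \<open>X / n \<ge> N\<close> for the last
    prime.\<close>
  define L where "L = 3 * J + 1"
  obtain c N1 where c: "c > 0" "\<And>N. N \<ge> N1 \<Longrightarrow> \<exists>B. finite B \<and> B \<subseteq> sqfree_practical \<and>
    (\<forall>n\<in>B. N ^ (4 + 3 * (2 * J)) \<le> n ^ 4 \<and> n \<le> N ^ (J + 2 * J)) \<and> c \<le> (\<Sum>n\<in>B. 1 / real n)"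
    using practical_reciprocal_sum_extend[OF c'(2,1,3), of N1' "2 * J"] by blast
  obtain \<delta> :: real and y0 where d: "\<delta> > 0" "\<delta> < 1"
    "\<And>y. y \<ge> y0 \<Longrightarrow> \<delta> * y / ln y \<le> real (card {p::nat. prime p \<and> \<delta> * y < real p \<and> real p \<le> y})"
    using primes_in_interval by blast
  \<comment> \<open>Up to \<open>4L\<close> primes of the interval may divide \<open>n\<close>; they
    should be at most half of those available.\<close>
  have "eventually (\<lambda>y::real. 4 * real L \<le> \<delta> * y / (2 * ln y)) at_top" using d(1) by real_asymp
  then obtain y1 where y1: "\<And>y. y \<ge> y1 \<Longrightarrow> 4 * real L \<le> \<delta> * y / (2 * ln y)"
    by (auto simp: eventually_at_top_linorder)
  \<comment> \<open>Keeps every last prime above the square root of \<open>N\<close>, so that a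
    product has boundedly many candidates for it.\<close>
  have "eventually (\<lambda>N::real. sqrt N \<le> \<delta> * N) at_top" using d(1) by real_asymp
  then obtain y2 where y2: "\<And>y. y \<ge> y2 \<Longrightarrow> sqrt y \<le> \<delta> * y" by (auto simp: eventually_at_top_linorder)
  \<comment> \<open>The entry \<open>2 ^ L\<close> turns \<open>X \<le> (2N)^L\<close> into
    \<open>X \<le> N^(L+1)\<close>, and \<open>L + 1 = 2 + 3J\<close> is the exponent known for
    \<open>n^2\<close>.\<close>
  define Y where "Y = max (max (max y0 y1) (max y2 2)) (max (real N1) (2 ^ L))"
  have L: "L \<ge> 1" by (simp add: L_def)
  \<comment> \<open>The 8 is a factor 2 for the primes dividing \<open>n\<close> times the 4 in the
    multiplicity bound \<open>4L\<close>.\<close>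
  define l where "l = c * \<delta> / (8 * real L)"
  have l: "l > 0" using c d L by (simp add: l_def)
  have "l * X / ln X \<le> real (card {n::nat. real n \<le> X \<and> n \<in> sqfree_practical})" if X: "X \<ge> (Y + 1) ^ L" for X
  proof -
    have Y: "Y \<ge> 2" by (simp add: Y_def)
    have X1: "X \<ge> 3"
    proof -
      have "(3::real) \<le> Y + 1" using Y by simp
      also have "\<dots> = (Y + 1) ^ 1" by simp
      also have "\<dots> \<le> (Y + 1) ^ L" using Y L by (intro power_increasing) auto
      finally show ?thesis using X by simp
    qed
    define N where "N = nat \<lfloor>X powr (1 / real L)\<rfloor>"
    have root: "(X powr (1 / real L)) ^ L = X"
      using X1 L by (simp add: powr_powr flip: powr_realpow)
    have "Y + 1 \<le> X powr (1 / real L)"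
    proof (rule ccontr)
      assume "\<not> ?thesis"
      hence "(X powr (1 / real L)) ^ L < (Y + 1) ^ L" using L by (intro power_strict_mono) auto
      thus False using X root by simp
    qed
    hence NY: "real N \<ge> Y" and N1: "real N \<le> X powr (1 / real L)" and N2: "X powr (1 / real L) \<le> real N + 1"
      unfolding N_def using Y by linarith+
    have N: "N \<ge> 2" "N \<ge> N1" "real N \<ge> 2 ^ L" "real N \<ge> y0" "real N \<ge> y1" "real N \<ge> y2"
      using NY by (auto simp: Y_def)
    have NX: "real N ^ L \<le> X" using power_mono[OF N1, of L] root by simp
    have "X \<le> (real N + 1) ^ L" using power_mono[OF N2, of L] root by simp
    also have "\<dots> \<le> (2 * real N) ^ L" using N by (intro power_mono) auto
    finally have XN: "X \<le> (2 * real N) ^ L" .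
    obtain B where B: "finite B" "B \<subseteq> sqfree_practical"
      "\<And>n. n \<in> B \<Longrightarrow> N ^ (4 + 3 * (2 * J)) \<le> n ^ 4 \<and> n \<le> N ^ (J + 2 * J)" "c \<le> (\<Sum>n\<in>B. 1 / real n)"
      using c(2)[OF N(2)] by blast
    have lnX: "ln X > 0" using X1 by simp
    have sN: "sqrt (real N) \<le> \<delta> * real N" using y2 N by blast
    have Bn: "n > 0" "real N \<le> X / real n" "X / real n \<le> real n" if n: "n \<in> B" for n
    proof -
      show n0: "n > 0" using n B sqfree_practical_pos by blast
      have "real n \<le> real N ^ (3 * J)" using B(3)[OF n] by (simp flip: of_nat_power)
      hence "real N * real n \<le> real N * real N ^ (3 * J)" by (intro mult_left_mono) auto
      also have "\<dots> \<le> X" using NX by (simp add: L_def)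
      finally show "real N \<le> X / real n" using n0 by (simp add: field_simps)
      have "(N ^ (2 + 3 * J)) ^ 2 \<le> (n ^ 2) ^ 2"
      proof -
        have e: "(2 + 3 * J) * 2 = 4 + 3 * (2 * J)" "2 * 2 = (4::nat)" by simp_all
        show ?thesis unfolding power_mult[symmetric] e using B(3)[OF n] by blast
      qed
      hence "N ^ (2 + 3 * J) \<le> n ^ 2" by (rule power2_le_imp_le) simp
      hence n2: "real N ^ (2 + 3 * J) \<le> real n ^ 2"
        unfolding of_nat_power[symmetric] of_nat_le_iff .
      have "X \<le> 2 ^ L * real N ^ L" using XN by (simp add: power_mult_distrib)
      also have "\<dots> \<le> real N * real N ^ L" using N by (intro mult_right_mono) auto
      also have "\<dots> = real N ^ (2 + 3 * J)" by (simp add: L_def)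
      finally have "X \<le> real n * real n" using n2 by (simp add: power2_eq_square)
      thus "X / real n \<le> real n" using n0 by (simp add: field_simps)
    qed
    define R where "R = (\<lambda>n. {p::nat. prime p \<and> \<delta> * (X / real n) < real p \<and> real p \<le> X / real n \<and> \<not> p dvd n})"
    define Q where "Q = {p::nat. real p \<le> X \<and> (prime p \<and> sqrt (real N) \<le> real p)}"
    have finQ: "finite Q" unfolding Q_def by (rule finite_nat_le_real)
    have large: "sqrt (real N) \<le> real p" if "n \<in> B" "\<delta> * (X / real n) < real p" for n p
    proof -
      have "\<delta> * real N \<le> \<delta> * (X / real n)" using Bn[OF that(1)] d by (intro mult_left_mono) auto
      thus ?thesis using sN that by linarith
    qed
    have RQ: "R n \<subseteq> Q" if n: "n \<in> B" for n
    proof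
      fix p assume p: "p \<in> R n"
      have "X / real n \<le> X / 1" using Bn(1)[OF n] X1 by (intro divide_left_mono) auto
      thus "p \<in> Q" using p large[OF n] by (auto simp: R_def Q_def)
    qed
    have finR: "finite (R n)" if "n \<in> B" for n using RQ[OF that] finQ finite_subset by blast
    have cardR: "\<delta> * X / (2 * ln X) * (1 / real n) \<le> real (card (R n))" if n: "n \<in> B" for n
    proof -
      define y where "y = X / real n"
      have y: "y \<ge> real N" "y \<le> X"
        using Bn[OF n] X1 by (auto simp: y_def field_simps mult_le_cancel_right1)
      have lny: "ln y > 0" "ln y \<le> ln X" using y N by auto
      let ?A = "{p::nat. prime p \<and> \<delta> * y < real p \<and> real p \<le> y}"
      let ?D = "{p\<in>?A. p dvd n}"
      have finA: "finite ?A"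
        by (rule finite_subset[OF _ finite_nat_le_real[of y "\<lambda>_. True"]]) auto
      have "1 \<le> X / real n" using Bn(2)[OF n] N(1) by linarith
      hence "real n \<le> X" using Bn(1)[OF n] by (simp add: field_simps)
      hence "real (card ?D) \<le> 4 * real L"
        using finA large[OF n] Bn(1)[OF n] XN N(1)
        by (intro card_large_prime_divisors_le[of _ n N L]) (auto simp: y_def)
      moreover have "?A = R n \<union> ?D" "R n \<inter> ?D = {}" by (auto simp: R_def y_def)
      hence "card ?A = card (R n) + card ?D" using finA by (metis (no_types, lifting) card_Un_disjoint finite_Un)
      moreover have "\<delta> * y / ln y \<le> real (card ?A)" using y N by (intro d(3)) auto
      moreover have "4 * real L \<le> \<delta> * y / (2 * ln y)" using y N by (intro y1) auto
      ultimately have "\<delta> * y / (2 * ln y) \<le> real (card (R n))" by (simp add: field_simps)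
      moreover have "\<delta> * y / (2 * ln X) \<le> \<delta> * y / (2 * ln y)"
        using lny d y N by (intro divide_left_mono) (auto intro!: mult_nonneg_nonneg mult_pos_pos)
      ultimately show ?thesis by (simp add: y_def mult_ac)
    qed
    define S where "S = (SIGMA n:B. R n)"
    define I where "I = (\<lambda>(n, p). p * n) ` S"
    have finS: "finite S" unfolding S_def using B(1) finR by auto
    have I: "k \<in> sqfree_practical \<and> real k \<le> X" if k: "k \<in> I" for k
    proof -
      obtain n p where np: "k = p * n" "n \<in> B" "p \<in> R n" using k by (auto simp: I_def S_def)
      have "real p \<le> X / real n" using np by (auto simp: R_def)
      hence "real p \<le> real n" "real p * real n \<le> X"
        using Bn[OF np(2)] by (linarith, simp add: field_simps)
      moreover have "k \<in> sqfree_practical"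
        unfolding np(1) using np B(2) \<open>real p \<le> real n\<close>
        by (intro sqfree_practical_mult_prime) (auto simp: R_def)
      ultimately show ?thesis by (simp add: np(1))
    qed
    have "\<delta> * X / (2 * ln X) * c \<le> \<delta> * X / (2 * ln X) * (\<Sum>n\<in>B. 1 / real n)"
      using B(4) d X1 lnX by (intro mult_left_mono) auto
    also have "\<dots> = (\<Sum>n\<in>B. \<delta> * X / (2 * ln X) * (1 / real n))" by (rule sum_distrib_left)
    also have "\<dots> \<le> (\<Sum>n\<in>B. real (card (R n)))" by (intro sum_mono cardR)
    also have "\<dots> = (\<Sum>n\<in>B. \<Sum>p\<in>R n. 1)" by simp
    also have "\<dots> = (\<Sum>(n, p)\<in>S. 1)" unfolding S_def using B(1) finR by (subst sum.Sigma) auto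
    also have "\<dots> \<le> (\<Sum>k\<in>I. real (card {p\<in>Q. p dvd k}) * 1)"
      unfolding I_def
      by (rule sum_pairs_le[where g = "\<lambda>_. 1"]) (use finS finQ RQ in \<open>auto simp: S_def Q_def\<close>)
    also have "\<dots> \<le> (\<Sum>k\<in>I. 4 * real L)"
    proof (intro sum_mono)
      fix k assume k: "k \<in> I"
      have "real (card {p\<in>Q. p dvd k}) \<le> 4 * real L"
        using finQ I[OF k] XN N(1) sqfree_practical_pos
        by (intro card_large_prime_divisors_le[of _ k N L]) (auto simp: Q_def)
      thus "real (card {p\<in>Q. p dvd k}) * 1 \<le> 4 * real L" by simp
    qed
    also have "\<dots> = 4 * real L * real (card I)" by simp
    also have "card I \<le> card {n::nat. real n \<le> X \<and> n \<in> sqfree_practical}"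
      using I by (intro card_mono finite_nat_le_real) auto
    finally have "\<delta> * X / (2 * ln X) * c \<le> 4 * real L * real (card {n::nat. real n \<le> X \<and> n \<in> sqfree_practical})"
      by (simp add: mult_left_mono)
    hence "\<delta> * X / (2 * ln X) * c / (4 * real L) \<le> real (card {n::nat. real n \<le> X \<and> n \<in> sqfree_practical})"
      using L by (subst pos_divide_le_eq) (auto simp: mult.commute)
    thus ?thesis by (simp add: l_def mult_ac)
  qed
  thus ?thesis using that l by blast
qed

theorem theorem5p3:
  "\<exists>l::real. l > 0 \<and> (\<forall>X::real. X \<ge> 2 \<longrightarrow>
     l * X / ln X \<le> real (card {n::nat. 0 < n \<and> real n \<le> X \<and> squarefree n \<and> phi_star_practical n})
     \<and> real (card {n::nat. 0 < n \<and> real n \<le> X \<and> squarefree n \<and> phi_star_practical n}) \<le> real (F_phi_star X))"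
proof -
  obtain l0 X0 where l0: "l0 > 0"
    "\<And>X. X \<ge> X0 \<Longrightarrow> l0 * X / ln X \<le> real (card {n::nat. real n \<le> X \<and> n \<in> sqfree_practical})"
    using practical_count_large by blast
  define X1 where "X1 = max X0 2"
  \<comment> \<open>For \<open>2 \<le> X < X1\<close> the number 1 is already counted, and
    \<open>l * X \<le> ln 2 \<le> ln X\<close> keeps the lower bound at most 1.\<close>
  define l where "l = min l0 (ln 2 / X1)"
  have X1: "X1 \<ge> 2" "X1 \<ge> X0" by (auto simp: X1_def)
  have l: "l > 0" "l \<le> l0" "l \<le> ln 2 / X1" using l0 X1 by (auto simp: l_def)
  have fin: "finite {n::nat. 0 < n \<and> real n \<le> X \<and> Q n}" for X :: real and Q
    by (rule finite_subset[OF _ finite_nat_le_real[of X "\<lambda>_. True"]]) auto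
  have "l * X / ln X \<le> real (card {n::nat. 0 < n \<and> real n \<le> X \<and> squarefree n \<and> phi_star_practical n})"
    if X: "X \<ge> 2" for X
  proof -
    let ?T = "{n::nat. 0 < n \<and> real n \<le> X \<and> squarefree n \<and> phi_star_practical n}"
    have sub: "{n::nat. real n \<le> X \<and> n \<in> sqfree_practical} \<subseteq> ?T"
      using sqfree_practical_pos by (auto simp: sqfree_practical_def)
    hence card: "card {n::nat. real n \<le> X \<and> n \<in> sqfree_practical} \<le> card ?T"
      by (intro card_mono fin)
    have lnX: "ln X > 0" using X by simp
    show ?thesis
    proof (cases "X \<ge> X1")
      case True
      have "l * X / ln X \<le> l0 * X / ln X"
        using l lnX X by (intro divide_right_mono mult_right_mono) auto
      also have "\<dots> \<le> real (card {n::nat. real n \<le> X \<and> n \<in> sqfree_practical})"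
        using True X1 by (intro l0(2)) auto
      finally show ?thesis using card by linarith
    next
      case False
      have "l * X \<le> ln 2 / X1 * X1" using l False X1 X by (intro mult_mono) auto
      also have "\<dots> = ln 2" using X1 by simp
      also have "\<dots> \<le> ln X" using X by simp
      finally have "l * X / ln X \<le> 1" using lnX by simp
      moreover have "1 \<in> ?T" by (rule subsetD[OF sub]) (use one_in_sqfree_practical X in simp)
      hence "card {1::nat} \<le> card ?T" by (intro card_mono fin) blast
      hence "card ?T \<ge> 1" by simp
      ultimately show ?thesis by linarith
    qed
  qed
  moreover have "card {n::nat. 0 < n \<and> real n \<le> X \<and> squarefree n \<and> phi_star_practical n} \<le> F_phi_star X" for X
    unfolding F_phi_star_def by (intro card_mono fin) auto
  ultimately show ?thesis using l(1) by (intro exI[of _ l]) auto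
qed

end
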